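(* Let $\Omega\subset\mathbb{C}$ be a bounded connected open set, $\varphi:\mathbb{D}\to\Omega$ an analytic covering map and $\overline{\varphi}$ its extension by radial limits. Let $p,q\in\overline\Omega$, $z\in\Omega$, and $\widehat z\in\mathbb{D}$ with $\varphi(\widehat z)=z$. (1) If $\gamma$ is a path in $\Omega$ (e.p.e.) joining $p$ and $q$ with $\gamma(s_0)=z$ for some $s_0\in[0,1]$, then there is a unique path $\widehat\gamma$ in $\mathbb{D}$ (e.p.e.) with $\overline{\varphi}\circ\widehat\gamma=\gamma$ and $\widehat\gamma(s_0)=\widehat z$. (2) If $h:[0,1]\times[0,1]\to\mathbb{C}$ is continuous such that for every $t\in[0,1]$ the path $h_t=h(\cdot,t)$ is a path in $\Omega$ (e.p.e.) joining $p$ and $q$, and $h(s_0,0)=z$ for some $s_0\in[0,1]$, then there is a unique continuous $\widehat h:[0,1]\times[0,1]\to\overline{\mathbb{D}}$ such that $\widehat h(s,t)\in\mathbb{D}$ and $\varphi(\widehat h(s,t))=h(s,t)$ for all $(s,t)\in(0,1)\times[0,1]$, $\widehat h(\{0\}\times[0,1])$ is a single point $\widehat p$ with $\overline\varphi(\widehat p)=p$, $\widehat h(\{1\}\times[0,1])$ is a single point $\widehat q$ with $\overline\varphi(\widehat q)=q$, and $\widehat h(s_0,0)=\widehat z$.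
   Context: $\mathbb{D}=\{z\in\mathbb{C}:|z|<1\}$. A path in $\Omega$ (e.p.e.) joining $p$ and $q$ is a continuous $\gamma:[0,1]\to\mathbb{C}$ with $\gamma(0)=p$, $\gamma(1)=q$, $\gamma((0,1))\subset\Omega$; similarly for paths in $\mathbb{D}$ (e.p.e.). The extended covering map $\overline\varphi$ is defined on $\mathbb{D}\cup\{\alpha\in\partial\mathbb{D}:\lim_{r\to1^-}\varphi(r\alpha)\text{ exists}\}$ by $\overline\varphi=\varphi$ on $\mathbb{D}$ and $\overline\varphi(\alpha)=\lim_{r\to1^-}\varphi(r\alpha)$ for such $\alpha\in\partial\mathbb{D}$ (not necessarily continuous at points of $\partial\mathbb{D}$). *)

theory Defs
  imports "HOL-Complex_Analysis.Complex_Analysis"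
begin

definition path_epe :: "complex set \<Rightarrow> complex \<Rightarrow> complex \<Rightarrow> (real \<Rightarrow> complex) \<Rightarrow> bool" where
  "path_epe S p q g \<longleftrightarrow> continuous_on {0..1} g \<and> g 0 = p \<and> g 1 = q \<and> g ` {0<..<1} \<subseteq> S"

definition ext_dom :: "(complex \<Rightarrow> complex) \<Rightarrow> complex set" where
  "ext_dom \<phi> = ball 0 1 \<union>
     {\<alpha>. cmod \<alpha> = 1 \<and> (\<exists>l. ((\<lambda>r::real. \<phi> (of_real r * \<alpha>)) \<longlongrightarrow> l) (at_left 1))}"

definition ext_phi :: "(complex \<Rightarrow> complex) \<Rightarrow> complex \<Rightarrow> complex" where
  "ext_phi \<phi> w = (if w \<in> ball 0 1 then \<phi> w
                   else Lim (at_left 1) (\<lambda>r::real. \<phi> (of_real r * w)))"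

end

theory Submission
  imports Defs
begin

text \<open>
  Away from the endpoints the lift comes from covering theory on a convex strip, so the point is
  its behaviour as the path approaches an endpoint \<open>p\<close>. If \<open>p\<close> lies in \<open>\<Omega>\<close>, the lift stays in one
  sheet over a neighbourhood of \<open>p\<close>. Otherwise it can accumulate only on the unit circle. Two
  distinct accumulation points would give arcs in the disc joining neighbourhoods of these points
  along which \<open>\<phi>\<close> tends to \<open>p\<close>, forcing \<open>\<phi>\<close> to be constant (Koebe); hence the lift converges to one
  boundary point, and the radial limit of \<open>\<phi>\<close> there is \<open>p\<close> (Lindelof). Both classical facts follow,
  by Moebius maps, from one estimate: a bounded function that is small on a path from near \<open>-1\<close> to
  near \<open>1\<close> is small at \<open>0\<close>. The estimate holds because, up to gaps near \<open>-1\<close> and \<open>1\<close>, the path and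
  its reflection separate \<open>0\<close> from the circle, so the maximum principle applies to
  \<open>f z * cnj (f (cnj z))\<close>. A single path is the case of a one-point parameter set.
\<close>

subsection \<open>A maximum principle across a crosscut\<close>

unbundle no fps_syntax

lemma crossing_paths_level_functions:
  fixes c g :: "real \<Rightarrow> 'a::topological_space" and \<xi> \<eta> :: "'a \<Rightarrow> real"
  assumes "path c" "path g"
    and cont: "continuous_on (path_image c \<union> path_image g) \<xi>"
      "continuous_on (path_image c \<union> path_image g) \<eta>"
    and c_ends: "\<xi> (pathstart c) \<le> l" "r \<le> \<xi> (pathfinish c)"
    and g_between: "\<And>y. y \<in> path_image g \<Longrightarrow> l < \<xi> y \<and> \<xi> y < r"
    and c_between: "\<And>x. x \<in> path_image c \<Longrightarrow> \<eta> (pathstart g) \<le> \<eta> x \<and> \<eta> x < \<eta> (pathfinish g)"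
    and g_above: "\<And>y. y \<in> path_image g \<Longrightarrow> \<eta> (pathstart g) \<le> \<eta> y"
  obtains x y where "x \<in> path_image c" "y \<in> path_image g" "\<xi> x = \<xi> y" "\<eta> x = \<eta> y"
proof -
  define lo hi where "lo = \<eta> (pathstart g)" and "hi = \<eta> (pathfinish g)"
  have "l < r" "lo < hi"
    using g_between[OF pathstart_in_path_image] c_between[OF pathstart_in_path_image]
    by (auto simp: lo_def hi_def)
  \<comment> \<open>Truncating the pair of level functions confines both paths to one rectangle.\<close>
  define V :: "'a \<Rightarrow> real^2"
    where "V z = (\<chi> i. if i = 1 then max l (min r (\<xi> z)) else min hi (\<eta> z))" for z
  have V1: "V z $ 1 = max l (min r (\<xi> z))" and V2: "V z $ 2 = min hi (\<eta> z)" for z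
    by (simp_all add: V_def)
  have "continuous_on (path_image c \<union> path_image g) V"
    unfolding V_def
  proof (rule continuous_on_vec_lambda)
    show "continuous_on (path_image c \<union> path_image g)
        (\<lambda>z. if i = 1 then max l (min r (\<xi> z)) else min hi (\<eta> z))" for i :: 2
      by (cases "i = 1") (auto intro!: continuous_intros cont)
  qed
  then have "path (V \<circ> c)" "path (V \<circ> g)"
    using assms(1,2) by (auto intro!: path_continuous_image intro: continuous_on_subset)
  moreover have "path_image (V \<circ> c) \<subseteq> cbox (vector [l, lo]) (vector [r, hi])"
    "path_image (V \<circ> g) \<subseteq> cbox (vector [l, lo]) (vector [r, hi])"
    using c_between g_above \<open>l < r\<close> \<open>lo < hi\<close>
    by (auto simp: path_image_compose mem_box_cart forall_2 V1 V2 lo_def[symmetric])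
  moreover have "pathstart (V \<circ> c) $ 1 = l" "pathfinish (V \<circ> c) $ 1 = r"
    "pathstart (V \<circ> g) $ 2 = lo" "pathfinish (V \<circ> g) $ 2 = hi"
    using c_ends \<open>l < r\<close> \<open>lo < hi\<close>
    by (auto simp: pathstart_compose pathfinish_compose V1 V2 lo_def[symmetric] hi_def[symmetric])
  ultimately obtain v where "v \<in> path_image (V \<circ> c)" "v \<in> path_image (V \<circ> g)"
    using fashoda[of "V \<circ> c" "V \<circ> g" "vector [l, lo]" "vector [r, hi]"] by auto
  then obtain x y where xy: "x \<in> path_image c" "y \<in> path_image g" "V x = V y"
    by (auto simp: path_image_compose)
  have "max l (min r (\<xi> x)) = max l (min r (\<xi> y))" "min hi (\<eta> x) = min hi (\<eta> y)"
    using xy(3) V1 V2 by metis+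
  then have "\<xi> x = \<xi> y" "\<eta> x = \<eta> y"
    using g_between[OF xy(2)] c_between[OF xy(1)] by (auto simp: hi_def min_def max_def split: if_splits)
  with xy show ?thesis
    using that by blast
qed

lemma open_norm_superlevel:
  fixes f :: "'a::topological_space \<Rightarrow> 'b::real_normed_vector"
  assumes "continuous_on S f" "open S"
  shows "open {x \<in> S. m < norm (f x)}"
proof -
  have "{x \<in> S. m < norm (f x)} = S \<inter> (\<lambda>x. norm (f x)) -` {m<..}" by auto
  also have "open \<dots>"
    using assms by (intro continuous_open_preimage continuous_on_norm) auto
  finally show ?thesis .
qed

lemma maximum_modulus_superlevel_component:
  assumes "G holomorphic_on D" "open D" "z \<in> D" "m < cmod (G z)" "compact K" "K \<subseteq> D"
  shows "\<not> connected_component_set {w \<in> D. m < cmod (G w)} z \<subseteq> K"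
proof
  define S where "S = {w \<in> D. m < cmod (G w)}"
  define U where "U = connected_component_set S z"
  assume "connected_component_set {w \<in> D. m < cmod (G w)} z \<subseteq> K"
  then have "U \<subseteq> K" by (simp add: U_def S_def)
  then have clU: "closure U \<subseteq> D"
    using closure_minimal[OF _ compact_imp_closed[OF assms(5)]] assms(6) by blast
  have "bounded U"
    using \<open>U \<subseteq> K\<close> assms(5) by (meson bounded_subset compact_imp_bounded)
  have contG: "continuous_on D G"
    using assms(1) by (rule holomorphic_on_imp_continuous_on)
  have "open S"
    unfolding S_def using contG \<open>open D\<close> by (rule open_norm_superlevel)
  have "cmod (G z) \<le> m"
  proof (rule maximum_modulus_frontier[of G U])
    show "G holomorphic_on interior U"
      using assms(1) clU closure_subset interior_subset by (meson holomorphic_on_subset order_trans)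
    show "continuous_on (closure U) G"
      using contG clU by (rule continuous_on_subset)
    show "cmod (G w) \<le> m" if "w \<in> frontier U" for w
    proof -
      have "w \<in> frontier S"
        using that frontier_of_connected_component_subset unfolding U_def by blast
      then have "w \<notin> S"
        using \<open>open S\<close> by (simp add: frontier_def interior_open)
      then show ?thesis
        using that clU by (auto simp: S_def frontier_def)
    qed
    show "z \<in> U"
      using assms(3,4) by (simp add: U_def S_def)
  qed fact
  with assms(4) show False by simp
qed

text \<open>In the disc the level curves are the elliptic arcs from \<open>-1\<close> to \<open>1\<close>, and the height tends to
  \<open>1\<close> at all other points of the circle.\<close>

definition disc_height :: "complex \<Rightarrow> real" where
  "disc_height z = (Im z)\<^sup>2 / (1 - (Re z)\<^sup>2)"

lemma Re_square_less_1: "z \<in> ball 0 1 \<Longrightarrow> (Re z)\<^sup>2 < 1"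
  using abs_Re_le_cmod[of z] by (simp add: abs_square_less_1)

lemma Im_square_eq_disc_height:
  assumes "z \<in> ball 0 1"
  shows "(Im z)\<^sup>2 = disc_height z * (1 - (Re z)\<^sup>2)"
  using Re_square_less_1[OF assms] by (simp add: disc_height_def)

lemma disc_height_bounds:
  assumes "z \<in> ball 0 1"
  shows "0 \<le> disc_height z" "disc_height z < 1"
proof -
  have "(Re z)\<^sup>2 + (Im z)\<^sup>2 < 1"
    using assms by (simp add: cmod_power2[symmetric] power_less_one_iff)
  with Re_square_less_1[OF assms] show "0 \<le> disc_height z" "disc_height z < 1"
    by (simp_all add: disc_height_def divide_simps)
qed

lemma continuous_on_disc_height: "continuous_on (ball 0 1) disc_height"
  unfolding disc_height_def by (intro continuous_intros) (use Re_square_less_1 in force)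

lemma norm_le_of_disc_height_le:
  assumes "z \<in> ball 0 1" "disc_height z \<le> \<rho>" "\<rho> \<le> 1" "\<bar>Re z\<bar> \<le> L"
  shows "cmod z \<le> sqrt (\<rho> + (1 - \<rho>) * L\<^sup>2)"
proof (rule real_le_rsqrt)
  have "(cmod z)\<^sup>2 = (Re z)\<^sup>2 + disc_height z * (1 - (Re z)\<^sup>2)"
    using Im_square_eq_disc_height[OF assms(1)] by (simp add: cmod_power2)
  also have "\<dots> \<le> (Re z)\<^sup>2 + \<rho> * (1 - (Re z)\<^sup>2)"
    using Re_square_less_1[OF assms(1)] assms(2) by (intro add_left_mono mult_right_mono) auto
  also have "\<dots> = \<rho> + (1 - \<rho>) * (Re z)\<^sup>2"
    by (simp add: algebra_simps)
  also have "\<dots> \<le> \<rho> + (1 - \<rho>) * L\<^sup>2"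
    using assms(3) power_mono[OF assms(4), of 2] by (intro add_left_mono mult_left_mono) auto
  finally show "(cmod z)\<^sup>2 \<le> \<rho> + (1 - \<rho>) * L\<^sup>2" .
qed

lemma eq_or_eq_cnj_of_disc_height_eq:
  assumes "x \<in> ball 0 1" "y \<in> ball 0 1" "Re x = Re y" "disc_height x = disc_height y"
  shows "x = y \<or> x = cnj y"
proof -
  have "(Im x)\<^sup>2 = (Im y)\<^sup>2"
    using assms Im_square_eq_disc_height by metis
  then show ?thesis
    using assms(3) by (auto simp: complex_eq_iff power2_eq_iff)
qed

lemma crossing_paths_in_disc:
  assumes c: "path c" "path_image c \<subseteq> ball 0 1" "Re (pathstart c) \<le> - L" "L \<le> Re (pathfinish c)"
    and g: "path g" "path_image g \<subseteq> ball 0 1" "pathstart g = 0"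
    and g_strip: "\<And>y. y \<in> path_image g \<Longrightarrow> \<bar>Re y\<bar> < L"
    and below: "\<And>x. x \<in> path_image c \<Longrightarrow> disc_height x < disc_height (pathfinish g)"
  obtains x y where "x \<in> path_image c" "y \<in> path_image g" "x = y \<or> x = cnj y"
proof -
  obtain x y where xy: "x \<in> path_image c" "y \<in> path_image g" "Re x = Re y" "disc_height x = disc_height y"
  proof (rule crossing_paths_level_functions[OF c(1) g(1) _ _ c(3,4)])
    show "continuous_on (path_image c \<union> path_image g) disc_height"
      using continuous_on_subset[OF continuous_on_disc_height] c(2) g(2) by blast
    show "- L < Re y \<and> Re y < L" if "y \<in> path_image g" for y
      using g_strip[OF that] by auto
    show "disc_height (pathstart g) \<le> disc_height x \<and> disc_height x < disc_height (pathfinish g)"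
      if "x \<in> path_image c" for x
      using that below c(2) disc_height_bounds(1)[of x] g(3) by (auto simp: disc_height_def[of 0])
    show "disc_height (pathstart g) \<le> disc_height y" if "y \<in> path_image g" for y
      using that g(2,3) disc_height_bounds(1)[of y] by (auto simp: disc_height_def[of 0])
  qed (auto intro!: continuous_intros)
  then show ?thesis
    using that eq_or_eq_cnj_of_disc_height_eq[of x y] c(2) g(2) by blast
qed

lemma superlevel_component_exceeds_disc_height:
  assumes holG: "G holomorphic_on ball 0 1" and "m < cmod (G 0)" and "L < 1" "\<rho> < 1"
    and small_ends: "\<And>z. z \<in> ball 0 1 \<Longrightarrow> L \<le> \<bar>Re z\<bar> \<Longrightarrow> cmod (G z) \<le> m"
  obtains w where "w \<in> connected_component_set {z \<in> ball 0 1. m < cmod (G z)} 0" "\<rho> < disc_height w"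
proof (rule ccontr)
  let ?U = "connected_component_set {z \<in> ball 0 1. m < cmod (G z)} 0"
  define R where "R = sqrt (\<rho> + (1 - \<rho>) * L\<^sup>2)"
  assume "\<not> thesis"
  then have height: "disc_height z \<le> \<rho>" if "z \<in> ?U" for z
    using that \<open>\<not> thesis\<close> \<open>\<And>w. w \<in> ?U \<Longrightarrow> \<rho> < disc_height w \<Longrightarrow> thesis\<close> by (meson not_le)
  have strip: "z \<in> ball 0 1" "\<bar>Re z\<bar> < L" if "z \<in> ?U" for z
    using subsetD[OF connected_component_subset that] small_ends[of z] by force+
  have "?U \<subseteq> cball 0 R"
  proof
    fix z assume "z \<in> ?U"
    then have "cmod z \<le> R"
      unfolding R_def using strip height \<open>\<rho> < 1\<close>
      by (intro norm_le_of_disc_height_le) (auto intro: less_imp_le)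
    then show "z \<in> cball 0 R" by simp
  qed
  moreover have "cball 0 R \<subseteq> ball (0::complex) 1"
  proof -
    have "0 < L" using strip(2)[of 0] \<open>m < cmod (G 0)\<close> by simp
    then have "L\<^sup>2 < 1" using \<open>L < 1\<close> by (simp add: power_less_one_iff)
    then have "(1 - \<rho>) * L\<^sup>2 < 1 - \<rho>" using \<open>\<rho> < 1\<close> by simp
    then show ?thesis by (simp add: R_def cball_subset_ball_iff)
  qed
  ultimately show False
    using maximum_modulus_superlevel_component[OF holG open_ball _ \<open>m < cmod (G 0)\<close> compact_cball] by simp
qed

text \<open>By the maximum principle the component of \<open>0\<close> in \<open>{\<bar>G\<bar> > m}\<close> climbs above \<open>c\<close>, so by the
  symmetry of \<open>\<bar>G\<bar>\<close> it meets \<open>c\<close>.\<close>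

lemma maximum_modulus_symmetric_crosscut:
  assumes holG: "G holomorphic_on ball 0 1"
    and sym: "\<And>z. z \<in> ball 0 1 \<Longrightarrow> cmod (G (cnj z)) = cmod (G z)"
    and c: "path c" "path_image c \<subseteq> ball 0 1" "Re (pathstart c) \<le> - L" "L \<le> Re (pathfinish c)"
    and small_c: "\<And>z. z \<in> path_image c \<Longrightarrow> cmod (G z) \<le> m"
    and small_ends: "\<And>z. z \<in> ball 0 1 \<Longrightarrow> L \<le> \<bar>Re z\<bar> \<Longrightarrow> cmod (G z) \<le> m"
  shows "cmod (G 0) \<le> m"
proof (rule ccontr)
  assume "\<not> cmod (G 0) \<le> m"
  then have G0: "m < cmod (G 0)" by simp
  define S where "S = {z \<in> ball 0 1. m < cmod (G z)}"
  define U where "U = connected_component_set S 0"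
  have US: "U \<subseteq> S" unfolding U_def by (rule connected_component_subset)
  have "L < 1"
    using c(2,4) pathfinish_in_path_image[of c] complex_Re_le_cmod[of "pathfinish c"] by force
  obtain x0 where x0: "x0 \<in> path_image c" "\<And>x. x \<in> path_image c \<Longrightarrow> disc_height x \<le> disc_height x0"
    using continuous_attains_sup[OF compact_path_image[OF c(1)] path_image_nonempty
        continuous_on_subset[OF continuous_on_disc_height c(2)]] by blast
  then have "disc_height x0 < 1"
    using c(2) disc_height_bounds(2) by blast
  then obtain w where w: "w \<in> U" "disc_height x0 < disc_height w"
    using superlevel_component_exceeds_disc_height[OF holG G0 \<open>L < 1\<close> _ small_ends]
    unfolding U_def S_def by blast
  have "open S"
    unfolding S_def using holomorphic_on_imp_continuous_on[OF holG] by (intro open_norm_superlevel) auto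
  then have "path_connected U"
    by (simp add: U_def open_connected_component connected_open_path_connected)
  moreover have "0 \<in> U" using G0 by (simp add: U_def S_def)
  ultimately obtain g where g: "path g" "path_image g \<subseteq> U" "pathstart g = 0" "pathfinish g = w"
    using w(1) unfolding path_connected_def by blast
  then have g_ball: "path_image g \<subseteq> ball 0 1" and g_large: "\<And>y. y \<in> path_image g \<Longrightarrow> m < cmod (G y)"
    using US by (auto simp: S_def)
  obtain x y where xy: "x \<in> path_image c" "y \<in> path_image g" "x = y \<or> x = cnj y"
  proof (rule crossing_paths_in_disc[OF c g(1) g_ball g(3)])
    show "\<bar>Re y\<bar> < L" if "y \<in> path_image g" for y
      using that g_ball g_large[OF that] small_ends[of y] by force
    show "disc_height x < disc_height (pathfinish g)" if "x \<in> path_image c" for x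
      using x0(2)[OF that] w(2) g(4) by simp
  qed
  then have "cmod (G x) = cmod (G y)"
    using g_ball sym by blast
  then show False
    using small_c[OF xy(1)] g_large[OF xy(2)] by simp
qed

subsection \<open>A two-constants estimate\<close>

lemma norm_one_minus_square_le:
  assumes "cmod z \<le> 1"
  shows "cmod (1 - z\<^sup>2) \<le> 2 * sqrt (1 - (Re z)\<^sup>2)"
proof -
  have z: "(Re z)\<^sup>2 + (Im z)\<^sup>2 \<le> 1"
    using assms by (simp add: cmod_power2[symmetric] power_le_one_iff)
  have Re: "\<bar>Re z\<bar> \<le> 1" using assms abs_Re_le_cmod[of z] by simp
  have "(cmod (1 - z))\<^sup>2 \<le> 2 * (1 - Re z)" "(cmod (1 + z))\<^sup>2 \<le> 2 * (1 + Re z)"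
    using z unfolding cmod_power2 by (simp_all add: power2_eq_square algebra_simps)
  then have "(cmod (1 - z))\<^sup>2 * (cmod (1 + z))\<^sup>2 \<le> (2 * (1 - Re z)) * (2 * (1 + Re z))"
    using Re by (intro mult_mono) auto
  moreover have "cmod (1 - z\<^sup>2) = cmod (1 - z) * cmod (1 + z)"
    by (simp add: power2_eq_square algebra_simps flip: norm_mult)
  ultimately have "(cmod (1 - z\<^sup>2))\<^sup>2 \<le> 4 * (1 - (Re z)\<^sup>2)"
    by (simp add: power_mult_distrib) (simp add: power2_eq_square algebra_simps)
  then have "cmod (1 - z\<^sup>2) \<le> sqrt (4 * (1 - (Re z)\<^sup>2))"
    by (rule real_le_rsqrt)
  then show ?thesis by (simp only: real_sqrt_mult real_sqrt_four)
qed

lemma norm_one_minus_square_le_sqrt: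
  assumes "cmod z \<le> 1" "1 - d \<le> \<bar>Re z\<bar>"
  shows "cmod (1 - z\<^sup>2) \<le> 2 * sqrt (2 * d)"
proof -
  have "\<bar>Re z\<bar> \<le> 1" using assms(1) abs_Re_le_cmod[of z] by simp
  then have "(1 - \<bar>Re z\<bar>) * (1 + \<bar>Re z\<bar>) \<le> d * 2"
    using assms(2) by (intro mult_mono) auto
  then have "1 - (Re z)\<^sup>2 \<le> 2 * d"
    by (simp add: power2_eq_square algebra_simps)
  then show ?thesis
    using norm_one_minus_square_le[OF assms(1)] real_sqrt_le_mono[of "1 - (Re z)\<^sup>2" "2 * d"]
    by (simp del: real_sqrt_le_iff)
qed

text \<open>The modulus is symmetric about the real axis. The last factor makes it small near \<open>-1\<close> and \<open>1\<close>,
  which closes the gaps left by the ends of a path.\<close>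

definition reflected_product :: "(complex \<Rightarrow> complex) \<Rightarrow> complex \<Rightarrow> complex" where
  "reflected_product f z = f z * (cnj \<circ> f \<circ> cnj) z * (1 - z\<^sup>2)"

lemma holomorphic_on_reflected_product:
  assumes "f holomorphic_on ball 0 1"
  shows "reflected_product f holomorphic_on ball 0 1"
proof -
  have "(cnj \<circ> f \<circ> cnj) holomorphic_on ball 0 1"
    using assms by (intro holomorphic_on_compose_cnj_cnj) (auto simp: image_cnj_conv_vimage_cnj)
  then show ?thesis
    unfolding reflected_product_def by (intro holomorphic_intros assms)
qed

lemma norm_reflected_product:
  "cmod (reflected_product f z) = cmod (f z) * cmod (f (cnj z)) * cmod (1 - z\<^sup>2)"
  by (simp add: reflected_product_def norm_mult)

lemma norm_reflected_product_cnj: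
  "cmod (reflected_product f (cnj z)) = cmod (reflected_product f z)"
  using complex_mod_cnj[of "1 - z\<^sup>2"] by (simp add: norm_reflected_product del: complex_mod_cnj)

lemma two_constants_at_0:
  assumes holf: "f holomorphic_on ball 0 1"
    and f_le: "\<And>z. z \<in> ball 0 1 \<Longrightarrow> cmod (f z) \<le> B"
    and C: "path_connected C" "C \<subseteq> ball 0 1"
    and small: "\<And>z. z \<in> C \<Longrightarrow> cmod (f z) \<le> e"
    and ends: "x \<in> C" "dist x (-1) \<le> d" "y \<in> C" "dist y 1 \<le> d"
  shows "(cmod (f 0))\<^sup>2 \<le> 2 * B * max e (B * sqrt (2 * d))"
proof -
  obtain c where c: "path c" "path_image c \<subseteq> C" "pathstart c = x" "pathfinish c = y"
    using C(1) ends(1,3) unfolding path_connected_def by blast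
  have "B \<ge> 0" using f_le[of 0] norm_ge_zero[of "f 0"] by (simp del: norm_ge_zero)
  define m where "m = 2 * B * max e (B * sqrt (2 * d))"
  have m: "2 * B * e \<le> m" "2 * B * (B * sqrt (2 * d)) \<le> m"
    using \<open>B \<ge> 0\<close> by (auto simp: m_def intro!: mult_left_mono)
  have "cmod (reflected_product f 0) \<le> m"
  proof (rule maximum_modulus_symmetric_crosscut[where c = c and L = "1 - d",
        OF holomorphic_on_reflected_product[OF holf] norm_reflected_product_cnj c(1)])
    show "path_image c \<subseteq> ball 0 1" using c(2) C(2) by blast
    show "Re (pathstart c) \<le> - (1 - d)" "1 - d \<le> Re (pathfinish c)"
      using ends(2,4) abs_Re_le_cmod[of "x + 1"] abs_Re_le_cmod[of "y - 1"]
      by (auto simp: c dist_norm)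
    show "cmod (reflected_product f z) \<le> m" if "z \<in> path_image c" for z
    proof -
      have z: "z \<in> C" "z \<in> ball 0 1" using that c(2) C(2) by auto
      have "cmod (1 - z\<^sup>2) \<le> 2"
        using norm_triangle_ineq4[of 1 "z\<^sup>2"] z(2) power_le_one[of "cmod z" 2] by (simp add: norm_power)
      moreover have "0 \<le> e" using order_trans[OF norm_ge_zero small[OF z(1)]] .
      ultimately have "cmod (reflected_product f z) \<le> e * B * 2"
        unfolding norm_reflected_product using small[OF z(1)] f_le[of "cnj z"] z(2) \<open>B \<ge> 0\<close>
        by (intro mult_mono) auto
      then show ?thesis using m(1) by (simp add: mult_ac)
    qed
    show "cmod (reflected_product f z) \<le> m" if z: "z \<in> ball 0 1" "1 - d \<le> \<bar>Re z\<bar>" for z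
    proof -
      have "cmod (reflected_product f z) \<le> B * B * (2 * sqrt (2 * d))"
        unfolding norm_reflected_product
        using norm_one_minus_square_le_sqrt[of z d] f_le[of z] f_le[of "cnj z"] z \<open>B \<ge> 0\<close>
        by (intro mult_mono) auto
      then show ?thesis using m(2) by (simp add: mult_ac)
    qed
  qed
  then show ?thesis by (simp add: m_def norm_reflected_product power2_eq_square)
qed

lemma Moebius_function_continuous_on_cball:
  assumes "cmod w < 1"
  shows "continuous_on (cball 0 1) (Moebius_function t w)"
proof -
  have "1 - cnj w * z \<noteq> 0" if "z \<in> cball 0 1" for z
  proof -
    have "cmod (cnj w * z) < 1"
      using assms that mult_left_le[of "cmod z" "cmod w"] by (simp add: norm_mult)
    then show ?thesis by auto
  qed
  then show ?thesis
    unfolding Moebius_function_def by (intro continuous_intros) auto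
qed

lemma Moebius_function_near_boundary_point:
  assumes "cmod w < 1" "cmod v = 1" "d > 0"
  obtains \<delta> where "\<delta> > 0"
    "\<And>x. x \<in> ball 0 1 \<Longrightarrow> dist x v < \<delta> \<Longrightarrow> dist (Moebius_function t w x) (Moebius_function t w v) \<le> d"
proof -
  have "v \<in> cball 0 1" using assms(2) by simp
  then obtain \<delta> where "\<delta> > 0"
    "\<And>x. x \<in> cball 0 1 \<Longrightarrow> dist x v < \<delta> \<Longrightarrow> dist (Moebius_function t w x) (Moebius_function t w v) < d"
    using Moebius_function_continuous_on_cball[OF assms(1), of t] assms(3)
    unfolding continuous_on_iff by metis
  then show ?thesis
    using that[of \<delta>] by (auto intro: less_imp_le)
qed

lemma cnj_mult_eq_1: "cmod z = 1 \<Longrightarrow> cnj z * z = 1"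
  by (simp add: complex_norm_square[symmetric] mult.commute)

lemma Moebius_function_norm_eq_1:
  assumes "cmod w < 1" "cmod z = 1"
  shows "cmod (Moebius_function t w z) = 1"
proof -
  have "1 - cnj w * z = z * cnj (z - w)"
    using cnj_mult_eq_1[OF assms(2)] by (simp add: algebra_simps)
  then have "cmod (1 - cnj w * z) = cmod (z - w)"
    by (simp add: norm_mult assms(2) del: complex_cnj_diff)
  then show ?thesis
    using assms by (auto simp: Moebius_function_def norm_divide norm_mult)
qed

lemma Moebius_function_radial_fixed:
  assumes "cmod \<alpha> = 1" "r < 1"
  shows "Moebius_function 0 (of_real r * \<alpha>) \<alpha> = \<alpha>"
proof -
  have "cnj \<alpha> * \<alpha> = 1"
    using assms(1) by (rule cnj_mult_eq_1)
  moreover have "\<alpha> - of_real r * \<alpha> = \<alpha> * (1 - of_real r)"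
    by (simp add: algebra_simps)
  moreover have "1 - of_real r \<noteq> (0::complex)"
    using assms(2) by (auto simp: complex_eq_iff)
  ultimately show ?thesis
    by (simp add: Moebius_function_simple mult.assoc)
qed

lemma Moebius_function_radial_tendsto:
  assumes "cmod \<alpha> = 1" "cmod z < 1"
  shows "((\<lambda>r. Moebius_function 0 (of_real r * \<alpha>) z) \<longlongrightarrow> - \<alpha>) (at_left 1)"
proof -
  have "cmod (cnj \<alpha> * z) < 1" using assms by (simp add: norm_mult)
  then have nz: "1 - cnj \<alpha> * z \<noteq> 0" by auto
  have "((\<lambda>r. Moebius_function 0 (of_real r * \<alpha>) z)
      \<longlongrightarrow> (z - of_real 1 * \<alpha>) / (1 - cnj (of_real 1 * \<alpha>) * z)) (at_left 1)"
    unfolding Moebius_function_simple using nz by (intro tendsto_intros) auto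
  moreover have "cnj \<alpha> * \<alpha> = 1"
    using assms(1) by (rule cnj_mult_eq_1)
  then have "z - \<alpha> = - \<alpha> * (1 - cnj \<alpha> * z)"
    by (simp add: algebra_simps)
  ultimately show ?thesis using nz by simp
qed

lemma two_constants:
  assumes holf: "f holomorphic_on ball 0 1"
    and f_le: "\<And>z. z \<in> ball 0 1 \<Longrightarrow> dist (f z) l \<le> B"
    and C: "path_connected C" "C \<subseteq> ball 0 1"
    and small: "\<And>z. z \<in> C \<Longrightarrow> dist (f z) l \<le> e"
    and w: "cmod w < 1" and u: "cmod u = 1"
    and ends: "x \<in> C" "dist (Moebius_function 0 w x) (- u) \<le> d"
      "y \<in> C" "dist (Moebius_function 0 w y) u \<le> d"
  shows "(dist (f w) l)\<^sup>2 \<le> 2 * B * max e (B * sqrt (2 * d))"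
proof -
  define S where "S z = cnj u * Moebius_function 0 w z" for z
  define M where "M z = Moebius_function 0 (- w) (u * z)" for z
  have uu: "u * cnj u = 1" "cnj u * u = 1"
    using cnj_mult_eq_1[OF u] by (simp_all add: mult.commute)
  have S_ball: "S z \<in> ball 0 1" if "z \<in> ball 0 1" for z
    using that w u Moebius_function_norm_lt_1[of w z] by (simp add: S_def norm_mult)
  have M_ball: "M z \<in> ball 0 1" if "z \<in> ball 0 1" for z
    using that w u Moebius_function_norm_lt_1[of "- w" "u * z"] by (simp add: M_def norm_mult)
  have MS: "M (S z) = z" if "z \<in> ball 0 1" for z
    using that w uu by (simp add: M_def S_def mult.assoc[symmetric] Moebius_function_compose)
  have dist_S: "dist (S z) (cnj u * v) = dist (Moebius_function 0 w z) v" for z v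
    using u by (simp add: S_def dist_norm norm_mult flip: right_diff_distrib)
  have "(cmod ((\<lambda>z. f (M z) - l) 0))\<^sup>2 \<le> 2 * B * max e (B * sqrt (2 * d))"
  proof (rule two_constants_at_0)
    have "M holomorphic_on ball 0 1"
      unfolding M_def using w u
      by (intro holomorphic_on_compose_gen[OF _ Moebius_function_holomorphic, unfolded o_def, of _ _ "- w" 0]
          holomorphic_intros) (auto simp: norm_mult)
    then show "(\<lambda>z. f (M z) - l) holomorphic_on ball 0 1"
      using M_ball by (intro holomorphic_intros holomorphic_on_compose_gen[OF _ holf, unfolded o_def]) auto
    show "cmod (f (M z) - l) \<le> B" if "z \<in> ball 0 1" for z
      using f_le[OF M_ball[OF that]] by (simp add: dist_norm)
    have "continuous_on C S"
      unfolding S_def using C(2) w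
      by (intro continuous_intros continuous_on_subset[OF Moebius_function_continuous_on_cball]) auto
    then show "path_connected (S ` C)"
      using C(1) by (rule path_connected_continuous_image)
    show "S ` C \<subseteq> ball 0 1" using C(2) S_ball by blast
    show "cmod (f (M z) - l) \<le> e" if "z \<in> S ` C" for z
      using that small C(2) MS by (auto simp: dist_norm subset_iff)
    show "S x \<in> S ` C" "S y \<in> S ` C" "dist (S x) (-1) \<le> d" "dist (S y) 1 \<le> d"
      using ends dist_S[of x "- u"] dist_S[of y u] uu by auto
  qed
  then show ?thesis by (simp add: M_def Moebius_function_of_zero dist_norm)
qed

lemma two_constants_bound_tendsto_0:
  "((\<lambda>d. 2 * B * max d (B * sqrt (2 * d))) \<longlongrightarrow> 0) (at_right 0)"
proof -
  have "isCont (\<lambda>d. 2 * B * max d (B * sqrt (2 * d))) 0"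
    by (intro continuous_intros)
  then have "((\<lambda>d. 2 * B * max d (B * sqrt (2 * d))) \<longlongrightarrow> 2 * B * max 0 (B * sqrt (2 * 0))) (at 0)"
    by (simp only: isCont_def)
  then show ?thesis by (simp add: filterlim_at_split)
qed

subsection \<open>Koebe's theorem\<close>

definition tends_along_arcs :: "(complex \<Rightarrow> complex) \<Rightarrow> complex \<Rightarrow> complex \<Rightarrow> complex \<Rightarrow> bool" where
  "tends_along_arcs f l a b \<longleftrightarrow>
     (\<forall>e>0. \<exists>C. path_connected C \<and> C \<subseteq> ball 0 1 \<and> C \<inter> ball a e \<noteq> {} \<and> C \<inter> ball b e \<noteq> {} \<and>
        (\<forall>z\<in>C. dist (f z) l < e))"

lemma tends_along_arcs_imp_eq_at_antipodal:
  assumes holf: "f holomorphic_on ball 0 1" and bdd: "bounded (f ` ball 0 1)"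
    and arcs: "tends_along_arcs f l a b" and ab: "cmod a = 1" "cmod b = 1"
    and w: "cmod w < 1" "Moebius_function 0 w a = - Moebius_function 0 w b"
  shows "f w = l"
proof -
  obtain B where B: "\<And>z. z \<in> ball 0 1 \<Longrightarrow> dist (f z) l \<le> B"
    using bdd unfolding bounded_any_center[where a = l] by (metis dist_commute imageI)
  have "(dist (f w) l)\<^sup>2 \<le> 2 * B * max d (B * sqrt (2 * d))" if "d > 0" for d
  proof -
    obtain \<delta>a where "\<delta>a > 0" and a: "\<And>x. x \<in> ball 0 1 \<Longrightarrow> dist x a < \<delta>a \<Longrightarrow>
        dist (Moebius_function 0 w x) (Moebius_function 0 w a) \<le> d"
      using Moebius_function_near_boundary_point[OF w(1) ab(1) \<open>d > 0\<close>] by blast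
    obtain \<delta>b where "\<delta>b > 0" and b: "\<And>x. x \<in> ball 0 1 \<Longrightarrow> dist x b < \<delta>b \<Longrightarrow>
        dist (Moebius_function 0 w x) (Moebius_function 0 w b) \<le> d"
      using Moebius_function_near_boundary_point[OF w(1) ab(2) \<open>d > 0\<close>] by blast
    have "min d (min \<delta>a \<delta>b) > 0" using \<open>d > 0\<close> \<open>\<delta>a > 0\<close> \<open>\<delta>b > 0\<close> by simp
    then obtain C where C: "path_connected C" "C \<subseteq> ball 0 1" "\<forall>z\<in>C. dist (f z) l < min d (min \<delta>a \<delta>b)"
      and C_ends: "C \<inter> ball a (min d (min \<delta>a \<delta>b)) \<noteq> {}" "C \<inter> ball b (min d (min \<delta>a \<delta>b)) \<noteq> {}"
      using arcs unfolding tends_along_arcs_def by meson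
    obtain x y where "x \<in> C" "dist x a < \<delta>a" "y \<in> C" "dist y b < \<delta>b"
      using C_ends by (auto simp: dist_commute)
    then have "dist (Moebius_function 0 w x) (- Moebius_function 0 w b) \<le> d"
      "dist (Moebius_function 0 w y) (Moebius_function 0 w b) \<le> d"
      using a[of x] b[of y] C(2) w(2) by auto
    then show ?thesis
      using C(3) \<open>x \<in> C\<close> \<open>y \<in> C\<close>
      by (intro two_constants[OF holf B C(1,2) _ w(1) Moebius_function_norm_eq_1[OF w(1) ab(2)]])
        (auto intro: less_imp_le)
  qed
  then have "eventually (\<lambda>d. (dist (f w) l)\<^sup>2 \<le> 2 * B * max d (B * sqrt (2 * d))) (at_right 0)"
    by (auto simp: eventually_at_filter)
  then have "(dist (f w) l)\<^sup>2 \<le> 0"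
    by (rule tendsto_lowerbound[OF two_constants_bound_tendsto_0]) simp
  then show ?thesis by simp
qed

lemma norm_add_scaleR_diff_less:
  fixes a b :: "'a::real_inner"
  assumes "norm a = norm b" "a \<noteq> b" "k > 0"
  shows "norm (a + k *\<^sub>R (b - a)) < norm (b + k *\<^sub>R (b - a))"
proof -
  define v where "v = k *\<^sub>R (b - a)"
  have "(norm (b + v))\<^sup>2 - (norm (a + v))\<^sup>2 = (norm b)\<^sup>2 - (norm a)\<^sup>2 + 2 * (v \<bullet> (b - a))"
    by (simp add: power2_norm_eq_inner inner_simps inner_commute)
  also have "\<dots> > 0"
    using assms by (simp add: v_def)
  finally have "(norm (a + v))\<^sup>2 < (norm (b + v))\<^sup>2" by simp
  then show ?thesis
    unfolding v_def by (rule power2_less_imp_less) simp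
qed

lemma Moebius_function_antipodal:
  fixes a b :: complex and k :: real
  defines "\<delta> \<equiv> k *\<^sub>R (b - a)"
  defines "w \<equiv> b * (a + \<delta>) / (b + \<delta>)"
  assumes ab: "cmod a = 1" "cmod b = 1" "a \<noteq> b" and "k > 0"
  shows "cmod w < 1" "Moebius_function 0 w a = - Moebius_function 0 w b"
proof -
  have ab_cnj: "cnj a = 1 / a" "cnj b = 1 / b" "a \<noteq> 0" "b \<noteq> 0"
    using ab cnj_mult_eq_1[of a] cnj_mult_eq_1[of b] by (auto simp: eq_divide_eq)
  have less: "cmod (a + \<delta>) < cmod (b + \<delta>)"
    unfolding \<delta>_def using ab \<open>k > 0\<close> by (intro norm_add_scaleR_diff_less) auto
  then have nz: "b + \<delta> \<noteq> 0" by auto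
  show "cmod w < 1"
    using less nz by (simp add: w_def norm_mult norm_divide ab)
  have "\<delta> \<noteq> 0" using ab(3) \<open>k > 0\<close> by (simp add: \<delta>_def)
  have cnj_\<delta>: "cnj \<delta> = - \<delta> / (a * b)"
    using ab_cnj(3,4) by (simp add: \<delta>_def scaleR_conv_of_real ab_cnj(1,2)) (simp add: field_simps)
  have "cnj (b + \<delta>) = (a - \<delta>) / (a * b)" "cnj (a + \<delta>) = (b - \<delta>) / (a * b)"
    using ab_cnj(3,4) by (simp_all add: ab_cnj(1,2) cnj_\<delta>) (simp_all add: field_simps)
  moreover have "cnj (b + \<delta>) \<noteq> 0" using nz complex_cnj_zero_iff by blast
  ultimately have nz': "a - \<delta> \<noteq> 0" and cnj_w: "cnj w = (b - \<delta>) / (b * (a - \<delta>))"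
    using ab_cnj by (auto simp: w_def)
  have "a - w = \<delta> * (a - b) / (b + \<delta>)" "b - w = - b * (a - b) / (b + \<delta>)"
    using nz by (simp_all add: w_def field_simps)
  moreover have "1 - cnj w * a = \<delta> * (a - b) / (b * (a - \<delta>))" "1 - cnj w * b = (a - b) / (a - \<delta>)"
    using nz' ab_cnj(4) by (simp_all add: cnj_w field_simps)
  ultimately show "Moebius_function 0 w a = - Moebius_function 0 w b"
    using nz nz' ab_cnj ab(3) \<open>\<delta> \<noteq> 0\<close> by (simp add: Moebius_function_simple)
qed

theorem Koebe_arcs:
  assumes holf: "f holomorphic_on ball 0 1" and bdd: "bounded (f ` ball 0 1)"
    and arcs: "tends_along_arcs f l a b" and ab: "cmod a = 1" "cmod b = 1" "a \<noteq> b"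
    and z: "z \<in> ball 0 1"
  shows "f z = l"
proof -
  \<comment> \<open>As \<open>k\<close> varies, \<open>w k\<close> runs through the hyperbolic geodesic from \<open>a\<close> to \<open>b\<close>.\<close>
  define w where "w k = b * (a + k *\<^sub>R (b - a)) / (b + k *\<^sub>R (b - a))" for k :: real
  have w: "w k \<in> ball 0 1" "f (w k) = l" if "k > 0" for k
    using tends_along_arcs_imp_eq_at_antipodal[OF holf bdd arcs ab(1,2)]
      Moebius_function_antipodal[OF ab that] by (auto simp: w_def)
  have nz: "b + k *\<^sub>R (b - a) \<noteq> 0" if "k > 0" for k
    using norm_add_scaleR_diff_less[of a b k] ab that by auto
  have "w 1 - w 2 = - b * (b - a)\<^sup>2 / ((b + 1 *\<^sub>R (b - a)) * (b + 2 *\<^sub>R (b - a)))"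
    using nz[of 1] nz[of 2] by (simp add: w_def scaleR_conv_of_real divide_simps)
      (simp add: power2_eq_square algebra_simps)
  then have "w 1 \<noteq> w 2"
    using nz[of 1] nz[of 2] ab by auto
  have "w 1 islimpt w ` {0<..}"
  proof (rule connected_imp_perfect)
    have "continuous_on {0<..} w"
      unfolding w_def using nz by (intro continuous_intros) auto
    then show "connected (w ` {0<..})"
      by (rule connected_continuous_image) simp
    show "w ` {0<..} \<noteq> {x}" for x
    proof
      assume "w ` {0<..} = {x}"
      then have "w 1 = x" "w 2 = x" by auto
      with \<open>w 1 \<noteq> w 2\<close> show False by simp
    qed
  qed simp
  have "f z - l = 0"
  proof (rule analytic_continuation[of "\<lambda>z. f z - l" "ball 0 1" "w ` {0<..}" "w 1"])
    show "(\<lambda>z. f z - l) holomorphic_on ball 0 1"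
      by (intro holomorphic_intros holf)
    show "w ` {0<..} \<subseteq> ball 0 1" "w 1 \<in> ball 0 1"
      using w(1) by (blast, simp del: mem_ball)
    show "f y - l = 0" if "y \<in> w ` {0<..}" for y
      using that w(2) by auto
  qed (use \<open>w 1 islimpt w ` {0<..}\<close> z in auto)
  then show ?thesis by simp
qed

subsection \<open>Filters with a base of path-connected sets\<close>

definition path_connected_filter :: "'a::topological_space filter \<Rightarrow> bool" where
  "path_connected_filter F \<longleftrightarrow>
     (\<forall>P. eventually P F \<longrightarrow> (\<exists>C. path_connected C \<and> eventually (\<lambda>x. x \<in> C) F \<and> (\<forall>x\<in>C. P x)))"

lemma path_connected_filterE:
  assumes "path_connected_filter F" "eventually P F"
  obtains C where "path_connected C" "eventually (\<lambda>x. x \<in> C) F" "\<And>x. x \<in> C \<Longrightarrow> P x"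
  using assms unfolding path_connected_filter_def by blast

lemma path_connected_filter_principal:
  "path_connected S \<Longrightarrow> path_connected_filter (principal S)"
  by (auto simp: path_connected_filter_def eventually_principal)

lemma path_connected_filter_at_right: "path_connected_filter (at_right (a::real))"
  unfolding path_connected_filter_def
proof (intro allI impI)
  fix P assume "eventually P (at_right a)"
  then obtain b where "a < b" "\<And>y. a < y \<Longrightarrow> y < b \<Longrightarrow> P y"
    by (auto simp: eventually_at_right_field)
  then show "\<exists>C. path_connected C \<and> eventually (\<lambda>x. x \<in> C) (at_right a) \<and> (\<forall>x\<in>C. P x)"
    by (intro exI[of _ "{a<..<b}"]) (auto intro: convex_imp_path_connected
        simp: eventually_at_right_field)
qed

lemma path_connected_filter_at_left: "path_connected_filter (at_left (a::real))"
  unfolding path_connected_filter_def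
proof (intro allI impI)
  fix P assume "eventually P (at_left a)"
  then obtain b where "b < a" "\<And>y. b < y \<Longrightarrow> y < a \<Longrightarrow> P y"
    by (auto simp: eventually_at_left_field)
  then show "\<exists>C. path_connected C \<and> eventually (\<lambda>x. x \<in> C) (at_left a) \<and> (\<forall>x\<in>C. P x)"
    by (intro exI[of _ "{b<..<a}"]) (auto intro: convex_imp_path_connected
        simp: eventually_at_left_field)
qed

lemma path_connected_filter_prod:
  assumes F: "path_connected_filter F" and G: "path_connected_filter G"
  shows "path_connected_filter (F \<times>\<^sub>F G)"
  unfolding path_connected_filter_def
proof (intro allI impI)
  fix P assume "eventually P (F \<times>\<^sub>F G)"
  then obtain Q R where QR: "eventually Q F" "eventually R G" "\<And>x y. Q x \<Longrightarrow> R y \<Longrightarrow> P (x, y)"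
    by (auto simp: eventually_prod_filter)
  obtain C where C: "path_connected C" "eventually (\<lambda>x. x \<in> C) F" "\<And>x. x \<in> C \<Longrightarrow> Q x"
    using path_connected_filterE[OF F QR(1)] by blast
  obtain D where D: "path_connected D" "eventually (\<lambda>y. y \<in> D) G" "\<And>y. y \<in> D \<Longrightarrow> R y"
    using path_connected_filterE[OF G QR(2)] by blast
  have "eventually (\<lambda>x. x \<in> C \<times> D) (F \<times>\<^sub>F G)"
    using eventually_prodI[OF C(2) D(2)] by (simp add: mem_Times_iff)
  then show "\<exists>C. path_connected C \<and> eventually (\<lambda>x. x \<in> C) (F \<times>\<^sub>F G) \<and> (\<forall>x\<in>C. P x)"
    using path_connected_Times[OF C(1) D(1)] C(3) D(3) QR(3) by (intro exI[of _ "C \<times> D"]) auto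
qed

lemma path_connected_filter_filtermap:
  assumes F: "path_connected_filter F" and "continuous_on S f" "eventually (\<lambda>x. x \<in> S) F"
  shows "path_connected_filter (filtermap f F)"
  unfolding path_connected_filter_def
proof (intro allI impI)
  fix P assume "eventually P (filtermap f F)"
  then have "eventually (\<lambda>x. x \<in> S \<and> P (f x)) F"
    using assms(3) by (simp add: eventually_filtermap eventually_conj)
  then obtain C where C: "path_connected C" "eventually (\<lambda>x. x \<in> C) F" "\<And>x. x \<in> C \<Longrightarrow> x \<in> S \<and> P (f x)"
    using path_connected_filterE[OF F] by blast
  have "path_connected (f ` C)"
    using C(1,3) by (intro path_connected_continuous_image continuous_on_subset[OF assms(2)]) auto
  moreover have "eventually (\<lambda>y. y \<in> f ` C) (filtermap f F)"
    unfolding eventually_filtermap using C(2) by eventually_elim auto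
  ultimately show "\<exists>C. path_connected C \<and> eventually (\<lambda>y. y \<in> C) (filtermap f F) \<and> (\<forall>y\<in>C. P y)"
    using C(3) by blast
qed

lemma cluster_point_frequently:
  assumes "inf (nhds a) F \<noteq> bot" "eventually P (nhds a)" "eventually Q F"
  obtains x where "P x" "Q x"
proof -
  have "eventually (\<lambda>x. P x \<and> Q x) (inf (nhds a) F)"
    using assms(2,3) by (auto simp: eventually_inf)
  then show ?thesis
    using eventually_happens'[OF assms(1)] that by blast
qed

lemma compact_unique_cluster_point_imp_le_nhds:
  assumes "compact K" "eventually (\<lambda>x. x \<in> K) F"
    and unique: "\<And>x. x \<in> K \<Longrightarrow> inf (nhds x) F \<noteq> bot \<Longrightarrow> x = a"
  shows "F \<le> nhds a"
proof (rule filter_leI)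
  fix P assume P: "eventually P (nhds a)"
  show "eventually P F"
  proof (rule ccontr)
    assume "\<not> eventually P F"
    define G where "G = inf F (principal {x. \<not> P x})"
    have "G \<noteq> bot"
      using \<open>\<not> eventually P F\<close> by (simp add: G_def trivial_limit_def eventually_inf_principal)
    moreover have "eventually (\<lambda>x. x \<in> K) G"
      using assms(2) by (simp add: G_def eventually_inf_principal eventually_mono)
    ultimately obtain x where x: "x \<in> K" "inf (nhds x) G \<noteq> bot"
      using assms(1) unfolding compact_filter by blast
    have "inf (nhds x) G \<le> inf (nhds x) F"
      by (auto simp: G_def intro: le_infI2)
    then have "x = a"
      using x unique by (metis bot_unique)
    moreover have "eventually (\<lambda>x. \<not> P x) G"
      by (simp add: G_def eventually_inf_principal)
    ultimately show False
      using cluster_point_frequently[OF x(2)] P by blast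
  qed
qed

subsection \<open>Asymptotic values along path-connected filters\<close>

lemma two_constants_radial:
  assumes holf: "f holomorphic_on ball 0 1"
    and f_le: "\<And>z. z \<in> ball 0 1 \<Longrightarrow> dist (f z) l \<le> B"
    and C: "path_connected C" "C \<subseteq> ball 0 1"
    and small: "\<And>z. z \<in> C \<Longrightarrow> dist (f z) l \<le> d"
    and \<alpha>: "cmod \<alpha> = 1" "\<alpha> \<in> closure C" and r: "0 < r" "r < 1" and "d > 0"
    and x: "x \<in> C" "dist (Moebius_function 0 (of_real r * \<alpha>) x) (- \<alpha>) \<le> d"
  shows "(dist (f (of_real r * \<alpha>)) l)\<^sup>2 \<le> 2 * B * max d (B * sqrt (2 * d))"
proof -
  define M where "M = Moebius_function 0 (of_real r * \<alpha>)"
  have w: "cmod (of_real r * \<alpha>) < 1" using r \<alpha>(1) by (simp add: norm_mult)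
  obtain \<delta> where \<delta>: "\<delta> > 0" "\<And>y. y \<in> ball 0 1 \<Longrightarrow> dist y \<alpha> < \<delta> \<Longrightarrow> dist (M y) (M \<alpha>) \<le> d"
    using Moebius_function_near_boundary_point[OF w \<alpha>(1) \<open>d > 0\<close>] unfolding M_def by blast
  obtain y where y: "y \<in> C" "dist y \<alpha> < \<delta>"
    using \<alpha>(2) \<delta>(1) unfolding closure_approachable by blast
  then have "dist (M y) \<alpha> \<le> d"
    using \<delta>(2)[of y] C(2) Moebius_function_radial_fixed[OF \<alpha>(1) r(2)] by (auto simp: M_def)
  then show ?thesis
    using two_constants[OF holf f_le C small w \<alpha>(1) x y(1)] unfolding M_def by blast
qed

theorem Lindelof_radial_limit:
  assumes holf: "f holomorphic_on ball 0 1" and bdd: "bounded (f ` ball 0 1)"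
    and F: "path_connected_filter F" "F \<noteq> bot" "eventually (\<lambda>z. z \<in> ball 0 1) F"
    and "F \<le> nhds \<alpha>" "cmod \<alpha> = 1" and lim: "(f \<longlongrightarrow> l) F"
  shows "((\<lambda>r::real. f (of_real r * \<alpha>)) \<longlongrightarrow> l) (at_left 1)"
proof (rule tendstoI)
  fix \<epsilon> :: real assume "\<epsilon> > 0"
  obtain B where B: "\<And>z. z \<in> ball 0 1 \<Longrightarrow> dist (f z) l \<le> B"
    using bdd unfolding bounded_any_center[where a = l] by (metis dist_commute imageI)
  have "eventually (\<lambda>d. 2 * B * max d (B * sqrt (2 * d)) < \<epsilon>\<^sup>2) (at_right 0)"
    using two_constants_bound_tendsto_0 by (rule order_tendstoD) (use \<open>\<epsilon> > 0\<close> in simp)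
  then have "eventually (\<lambda>d. 2 * B * max d (B * sqrt (2 * d)) < \<epsilon>\<^sup>2 \<and> 0 < d) (at_right 0)"
    using eventually_at_right_less by (rule eventually_conj)
  then obtain d where d: "2 * B * max d (B * sqrt (2 * d)) < \<epsilon>\<^sup>2" "d > 0"
    using eventually_happens'[OF trivial_limit_at_right_real] by blast
  obtain C where C: "path_connected C" "eventually (\<lambda>z. z \<in> C) F"
    and C_in: "\<And>z. z \<in> C \<Longrightarrow> z \<in> ball 0 1 \<and> dist (f z) l < d"
    using path_connected_filterE[OF F(1) eventually_conj[OF F(3) tendstoD[OF lim d(2)]]] by blast
  then have C_ball: "C \<subseteq> ball 0 1" and small: "\<And>z. z \<in> C \<Longrightarrow> dist (f z) l \<le> d"
    by (auto intro: less_imp_le)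
  obtain x where x: "x \<in> C" "cmod x < 1"
    using eventually_happens[OF C(2)] F(2) C_ball by auto
  have "eventually (\<lambda>z. z \<in> closure C) F"
    using C(2) by eventually_elim (rule subsetD[OF closure_subset])
  moreover have "((\<lambda>z. z) \<longlongrightarrow> \<alpha>) F"
    using \<open>F \<le> nhds \<alpha>\<close> by (simp add: filterlim_def)
  ultimately have "\<alpha> \<in> closure C"
    by (rule Lim_in_closed_set[OF closed_closure _ F(2)])
  have "eventually (\<lambda>r. dist (Moebius_function 0 (complex_of_real r * \<alpha>) x) (- \<alpha>) < d) (at_left 1)"
    using Moebius_function_radial_tendsto[OF \<open>cmod \<alpha> = 1\<close> x(2)] d(2) by (rule tendstoD)
  moreover have "eventually (\<lambda>r::real. r \<in> {0<..<1}) (at_left 1)"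
    by (rule eventually_at_left_real) simp
  ultimately show "eventually (\<lambda>r::real. dist (f (of_real r * \<alpha>)) l < \<epsilon>) (at_left 1)"
  proof eventually_elim
    case (elim r)
    then have "(dist (f (of_real r * \<alpha>)) l)\<^sup>2 \<le> 2 * B * max d (B * sqrt (2 * d))"
      by (intro two_constants_radial[OF holf B C(1) C_ball small \<open>cmod \<alpha> = 1\<close> \<open>\<alpha> \<in> closure C\<close> _ _ d(2) x(1)])
        simp_all
    then have "(dist (f (of_real r * \<alpha>)) l)\<^sup>2 < \<epsilon>\<^sup>2"
      using d(1) by simp
    then show ?case
      by (rule power2_less_imp_less) (use \<open>\<epsilon> > 0\<close> in simp)
  qed
qed

lemma tends_along_arcs_cluster_points:
  assumes F: "path_connected_filter F" "eventually (\<lambda>z. z \<in> ball 0 1) F" and lim: "(f \<longlongrightarrow> l) F"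
    and ab: "inf (nhds a) F \<noteq> bot" "inf (nhds b) F \<noteq> bot"
  shows "tends_along_arcs f l a b"
  unfolding tends_along_arcs_def
proof (intro allI impI)
  fix e :: real assume "e > 0"
  obtain C where C: "path_connected C" "eventually (\<lambda>z. z \<in> C) F"
    "\<And>z. z \<in> C \<Longrightarrow> z \<in> ball 0 1 \<and> dist (f z) l < e"
    using path_connected_filterE[OF F(1) eventually_conj[OF F(2) tendstoD[OF lim \<open>e > 0\<close>]]] by blast
  have "C \<inter> ball v e \<noteq> {}" if "inf (nhds v) F \<noteq> bot" for v
  proof -
    have "eventually (\<lambda>z. z \<in> ball v e) (nhds v)"
      using \<open>e > 0\<close> by (intro eventually_nhds_in_open) auto
    then show ?thesis
      using cluster_point_frequently[OF that _ C(2)] by (metis IntI empty_iff)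
  qed
  with ab C show "\<exists>C. path_connected C \<and> C \<subseteq> ball 0 1 \<and> C \<inter> ball a e \<noteq> {} \<and> C \<inter> ball b e \<noteq> {} \<and>
      (\<forall>z\<in>C. dist (f z) l < e)"
    by (intro exI[of _ C]) auto
qed

lemma omitted_asymptotic_value_filter_converges:
  assumes holf: "f holomorphic_on ball 0 1" and bdd: "bounded (f ` ball 0 1)"
    and F: "path_connected_filter F" "F \<noteq> bot" "eventually (\<lambda>z. z \<in> ball 0 1) F"
    and lim: "(f \<longlongrightarrow> l) F" and omitted: "l \<notin> f ` ball 0 1"
  obtains \<alpha> where "cmod \<alpha> = 1" "F \<le> nhds \<alpha>"
proof -
  have F_cball: "eventually (\<lambda>z. z \<in> cball 0 1) F"
    using F(3) by eventually_elim simp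
  have on_circle: "cmod a = 1" if a: "a \<in> cball 0 1" "inf (nhds a) F \<noteq> bot" for a
  proof (rule ccontr)
    assume "cmod a \<noteq> 1"
    then have "a \<in> ball 0 1" using a(1) by simp
    then have "isCont f a"
      using holomorphic_on_imp_continuous_on[OF holf] by (simp add: continuous_on_eq_continuous_at)
    then have "(f \<longlongrightarrow> f a) (nhds a)"
      by (simp add: isCont_def tendsto_at_iff_tendsto_nhds)
    then have "(f \<longlongrightarrow> f a) (inf (nhds a) F)"
      by (rule tendsto_mono[rotated]) simp
    moreover have "(f \<longlongrightarrow> l) (inf (nhds a) F)"
      using lim by (rule tendsto_mono[rotated]) simp
    ultimately have "f a = l"
      using tendsto_unique a(2) by blast
    with omitted \<open>a \<in> ball 0 1\<close> show False by blast
  qed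
  obtain \<alpha> where \<alpha>: "\<alpha> \<in> cball 0 1" "inf (nhds \<alpha>) F \<noteq> bot"
    using compact_cball F(2) F_cball unfolding compact_filter by blast
  have "F \<le> nhds \<alpha>"
  proof (rule compact_unique_cluster_point_imp_le_nhds[OF compact_cball F_cball])
    fix b assume b: "b \<in> cball 0 1" "inf (nhds b) F \<noteq> bot"
    show "b = \<alpha>"
    proof (rule ccontr)
      assume "b \<noteq> \<alpha>"
      then have "f 0 = l"
        using Koebe_arcs[OF holf bdd tends_along_arcs_cluster_points[OF F(1,3) lim b(2) \<alpha>(2)]
            on_circle[OF b] on_circle[OF \<alpha>]] by simp
      with omitted show False by force
    qed
  qed
  with on_circle[OF \<alpha>] show ?thesis by (rule that)
qed

subsection \<open>Convergence of lifts\<close>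

lemma connected_subset_disjoint_open_Union:
  assumes "connected C" "C \<noteq> {}" "C \<subseteq> \<Union>\<V>" "pairwise disjnt \<V>"
    and "\<And>U. U \<in> \<V> \<Longrightarrow> openin (top_of_set S) U"
  obtains U where "U \<in> \<V>" "C \<subseteq> U"
proof -
  obtain x U where x: "x \<in> C" "x \<in> U" "U \<in> \<V>"
    using assms(2,3) by blast
  define W where "W = \<Union>(\<V> - {U})"
  have "\<Union>\<V> \<subseteq> S"
    using assms(5) openin_subset by fastforce
  then have "C \<subseteq> S" using assms(3) by blast
  have open_Int: "openin (top_of_set C) (C \<inter> V)" if "openin (top_of_set S) V" for V
    using that \<open>C \<subseteq> S\<close> unfolding openin_open by blast
  have "openin (top_of_set S) W"
    using assms(5) by (auto simp: W_def)
  then have "openin (top_of_set C) (C \<inter> U)" "openin (top_of_set C) (C \<inter> W)"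
    using open_Int assms(5)[OF x(3)] by blast+
  moreover have "C \<inter> U \<inter> (C \<inter> W) = {}"
    using assms(4) x(3) by (auto simp: W_def pairwise_def disjnt_def)
  moreover have "C \<subseteq> C \<inter> U \<union> C \<inter> W"
    using assms(3) by (auto simp: W_def)
  ultimately have "C \<inter> W = {}"
    using assms(1) x(1,2) unfolding connected_openin by blast
  then have "C \<subseteq> U"
    using assms(3) unfolding W_def by blast
  then show ?thesis using that x(3) by blast
qed

lemma covering_space_filter_converges:
  assumes cov: "covering_space S p T" and F: "path_connected_filter F" "F \<noteq> bot"
    and F_in: "eventually (\<lambda>x. x \<in> S) F" and lim: "(p \<longlongrightarrow> y) F" "y \<in> T"
  obtains x where "x \<in> S" "p x = y" "F \<le> nhds x"
proof -
  obtain V \<U> where V: "y \<in> V" "openin (top_of_set T) V"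
    and \<U>: "\<Union>\<U> = S \<inter> p -` V" "\<And>U. U \<in> \<U> \<Longrightarrow> openin (top_of_set S) U" "pairwise disjnt \<U>"
    and sheet: "\<And>U. U \<in> \<U> \<Longrightarrow> \<exists>q. homeomorphism U V p q"
    using cov lim(2) unfolding covering_space_def by metis
  obtain W where W: "open W" "V = T \<inter> W"
    using V(2) by (auto simp: openin_open)
  have "eventually (\<lambda>x. p x \<in> W) F"
    using lim(1) W V(1) by (auto intro: topological_tendstoD)
  then have "eventually (\<lambda>x. x \<in> S \<and> p x \<in> W) F"
    using F_in by (simp add: eventually_conj)
  then obtain C where C: "path_connected C" "eventually (\<lambda>x. x \<in> C) F" "\<And>x. x \<in> C \<Longrightarrow> x \<in> S \<and> p x \<in> W"
    using path_connected_filterE[OF F(1)] by blast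
  have "C \<noteq> {}" using C(2) F(2) by auto
  moreover have "C \<subseteq> \<Union>\<U>"
    using C(3) W(2) covering_space_imp_surjective[OF cov] unfolding \<U>(1) by blast
  ultimately obtain U where U: "U \<in> \<U>" "C \<subseteq> U"
    using connected_subset_disjoint_open_Union path_connected_imp_connected[OF C(1)] \<U>(2,3) by metis
  obtain q where q: "homeomorphism U V p q"
    using sheet[OF U(1)] by blast
  have U_F: "eventually (\<lambda>x. x \<in> U) F"
    using C(2) U(2) by (auto elim: eventually_mono)
  have "((\<lambda>x. q (p x)) \<longlongrightarrow> q y) F"
  proof (rule continuous_on_tendsto_compose[OF _ lim(1) V(1)])
    show "continuous_on V q" using q by (simp add: homeomorphism_def)
    show "eventually (\<lambda>x. p x \<in> V) F"
      using U_F by eventually_elim (use q in \<open>auto simp: homeomorphism_def\<close>)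
  qed
  moreover have "eventually (\<lambda>x. q (p x) = x) F"
    using U_F by eventually_elim (use q in \<open>auto simp: homeomorphism_def\<close>)
  ultimately have "((\<lambda>x. x) \<longlongrightarrow> q y) F"
    by (rule Lim_transform_eventually)
  then have "F \<le> nhds (q y)"
    by (simp add: filterlim_def)
  moreover have "q y \<in> U" "p (q y) = y"
    using q V(1) by (auto simp: homeomorphism_def)
  then have "q y \<in> S" using \<U>(1) U(1) by blast
  ultimately show ?thesis using that \<open>p (q y) = y\<close> by blast
qed

lemma ext_phi_ball:
  assumes "w \<in> ball 0 1"
  shows "w \<in> ext_dom \<phi>" "ext_phi \<phi> w = \<phi> w"
  using assms by (simp_all add: ext_dom_def ext_phi_def)

lemma ext_phi_radial_limit:
  assumes "cmod w = 1" "((\<lambda>r::real. \<phi> (of_real r * w)) \<longlongrightarrow> l) (at_left 1)"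
  shows "w \<in> ext_dom \<phi>" "ext_phi \<phi> w = l"
  using assms tendsto_Lim[OF _ assms(2)] by (auto simp: ext_dom_def ext_phi_def)

lemma ext_dom_subset_cball: "ext_dom \<phi> \<subseteq> cball 0 1"
  by (auto simp: ext_dom_def)

lemma lift_converges_in_ext_dom:
  assumes bdd: "bounded \<Omega>" and hol: "\<phi> holomorphic_on ball 0 1"
    and cov: "covering_space (ball 0 1) \<phi> \<Omega>"
    and F: "path_connected_filter F" "F \<noteq> bot" "eventually (\<lambda>x. x \<in> S) F"
    and H: "continuous_on S H" "H \<in> S \<rightarrow> ball 0 1" and lim: "((\<lambda>x. \<phi> (H x)) \<longlongrightarrow> p) F"
  obtains w where "w \<in> ext_dom \<phi>" "ext_phi \<phi> w = p" "(H \<longlongrightarrow> w) F"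
proof -
  let ?G = "filtermap H F"
  have G: "path_connected_filter ?G" "?G \<noteq> bot" "(\<phi> \<longlongrightarrow> p) ?G"
    using path_connected_filter_filtermap[OF F(1) H(1) F(3)] F(2) lim
    by (simp_all add: filtermap_bot_iff filterlim_filtermap)
  have G_ball: "eventually (\<lambda>z. z \<in> ball 0 1) ?G"
    unfolding eventually_filtermap using F(3) by eventually_elim (use H(2) in auto)
  have image: "\<phi> ` ball 0 1 = \<Omega>"
    using cov by (rule covering_space_imp_surjective)
  have "\<exists>w. w \<in> ext_dom \<phi> \<and> ext_phi \<phi> w = p \<and> ?G \<le> nhds w"
  proof (cases "p \<in> \<Omega>")
    case True
    obtain w where "w \<in> ball 0 1" "\<phi> w = p" "?G \<le> nhds w"
      using covering_space_filter_converges[OF cov G(1,2) G_ball G(3) True] by blast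
    then show ?thesis using ext_phi_ball by metis
  next
    case False
    obtain w where w: "cmod w = 1" "?G \<le> nhds w"
      using omitted_asymptotic_value_filter_converges[OF hol _ G(1,2) G_ball G(3)] bdd False image by metis
    moreover have "((\<lambda>r::real. \<phi> (of_real r * w)) \<longlongrightarrow> p) (at_left 1)"
      using Lindelof_radial_limit[OF hol _ G(1,2) G_ball w(2,1) G(3)] bdd image by simp
    ultimately show ?thesis using ext_phi_radial_limit by blast
  qed
  then show ?thesis using that by (auto simp: filterlim_def)
qed

subsection \<open>Extending a family to the ends of the interval\<close>

lemma tendsto_at_within_prod_principal:
  fixes f :: "'a::topological_space \<times> 'b::topological_space \<Rightarrow> 'c::metric_space"
  assumes "continuous_on (S \<times> T) f" "compact T" "a \<in> S" and const: "\<And>t. t \<in> T \<Longrightarrow> f (a, t) = l"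
  shows "(f \<longlongrightarrow> l) ((at a within S) \<times>\<^sub>F principal T)"
proof (rule tendstoI)
  fix e :: real assume "e > 0"
  obtain U where U: "a \<in> U" "open U" "\<forall>x\<in>U \<inter> S. \<forall>t\<in>T. dist (f (x, t)) (f (a, t)) \<le> e / 2"
    using continuous_on_prod_compactE[OF assms(1-3) half_gt_zero[OF \<open>e > 0\<close>]] by blast
  have "eventually (\<lambda>x. x \<in> U \<inter> S) (at a within S)"
    using U(1,2) by (auto simp: eventually_at_topological)
  then have "eventually (\<lambda>x. fst x \<in> U \<inter> S \<and> snd x \<in> T) ((at a within S) \<times>\<^sub>F principal T)"
    by (rule eventually_prodI) (simp add: eventually_principal)
  then show "eventually (\<lambda>x. dist (f x) l < e) ((at a within S) \<times>\<^sub>F principal T)"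
  proof eventually_elim
    case (elim x)
    then have "dist (f x) l \<le> e / 2"
      using U(3) const by (metis prod.collapse)
    with \<open>e > 0\<close> show ?case by simp
  qed
qed

lemma at_within_Times_le:
  assumes "a \<notin> S"
  shows "at (a, t) within S \<times> T \<le> (at a within S) \<times>\<^sub>F principal T"
proof (rule le_prod_filterI)
  have "eventually (\<lambda>x. x \<in> S \<times> T) (at (a, t) within S \<times> T)"
    by (simp add: eventually_at_topological) auto
  then have in_S: "eventually (\<lambda>x. fst x \<in> S \<and> fst x \<noteq> a) (at (a, t) within S \<times> T)"
    and in_T: "eventually (\<lambda>x. snd x \<in> T) (at (a, t) within S \<times> T)"
    using assms by (auto elim!: eventually_mono)
  have "(fst \<longlongrightarrow> fst (a, t)) (at (a, t) within S \<times> T)"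
    by (intro tendsto_intros)
  with in_S show "filtermap fst (at (a, t) within S \<times> T) \<le> at a within S"
    by (simp add: filterlim_at flip: filterlim_def)
  show "filtermap snd (at (a, t) within S \<times> T) \<le> principal T"
    using in_T by (simp add: filterlim_principal flip: filterlim_def)
qed

lemma continuous_on_extend_end:
  fixes f :: "'a::t1_space \<times> 'b::topological_space \<Rightarrow> 'c::topological_space"
  assumes cont: "continuous_on (S \<times> T) f" and "a \<notin> S"
    and lim: "(f \<longlongrightarrow> l) ((at a within S) \<times>\<^sub>F principal T)"
  shows "continuous_on (insert a S \<times> T) (\<lambda>x. if fst x = a then l else f x)" (is "continuous_on _ ?g")
  unfolding continuous_on_def
proof
  fix x assume "x \<in> insert a S \<times> T"
  then obtain s t where x: "x = (s, t)" "s \<in> insert a S" "t \<in> T" by auto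
  have g_eq: "eventually (\<lambda>y. f y = ?g y) (at x within S \<times> T)"
    using \<open>a \<notin> S\<close> by (auto simp: eventually_at_topological)
  have decomp: "insert a S \<times> T = {a} \<times> T \<union> S \<times> T" by auto
  show "(?g \<longlongrightarrow> ?g x) (at x within insert a S \<times> T)"
  proof (cases "s = a")
    case True
    have "(f \<longlongrightarrow> l) (at x within S \<times> T)"
      using tendsto_mono[OF at_within_Times_le[OF \<open>a \<notin> S\<close>] lim] x True by simp
    then have "(?g \<longlongrightarrow> l) (at x within S \<times> T)"
      using g_eq by (rule Lim_transform_eventually)
    moreover have "(?g \<longlongrightarrow> l) (at x within {a} \<times> T)"
      by (rule tendsto_eventually) (auto simp: eventually_at_topological)
    ultimately show ?thesis
      unfolding decomp Lim_within_Un using x True by simp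
  next
    case False
    have "(f \<longlongrightarrow> f x) (at x within S \<times> T)"
      using cont x False by (auto simp: continuous_on_def)
    then have "(?g \<longlongrightarrow> f x) (at x within S \<times> T)"
      using g_eq by (rule Lim_transform_eventually)
    moreover have "at x within insert a S \<times> T = at x within S \<times> T"
      by (rule at_within_nhd[of _ "(- {a}) \<times> UNIV"]) (use x False in \<open>auto intro: open_Times\<close>)
    ultimately show ?thesis using x False by simp
  qed
qed

lemma continuous_on_eq_on_dense:
  fixes f g :: "'a::topological_space \<Rightarrow> 'b::metric_space"
  assumes "continuous_on S f" "continuous_on S g" "D \<subseteq> S" "S \<subseteq> closure D"
    and "\<And>x. x \<in> D \<Longrightarrow> f x = g x" and "x \<in> S"
  shows "f x = g x"
  using assms
  by (intro forall_in_closure_of_eq[of x "top_of_set S" D euclidean f g])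
    (auto simp: closure_of_subtopology Int_absorb1)

lemma continuous_on_extend_ends:
  fixes f :: "real \<times> 'a::topological_space \<Rightarrow> 'b::topological_space"
  assumes "a < b" and cont: "continuous_on ({a<..<b} \<times> T) f"
    and lim_a: "(f \<longlongrightarrow> l) (at_right a \<times>\<^sub>F principal T)"
    and lim_b: "(f \<longlongrightarrow> m) (at_left b \<times>\<^sub>F principal T)"
  shows "continuous_on ({a..b} \<times> T) (\<lambda>x. if fst x = b then m else if fst x = a then l else f x)"
proof -
  define g where "g x = (if fst x = a then l else f x)" for x
  have "(f \<longlongrightarrow> l) ((at a within {a<..<b}) \<times>\<^sub>F principal T)"
    using lim_a by (rule tendsto_mono[rotated]) (auto intro!: prod_filter_mono at_le)
  then have "continuous_on (insert a {a<..<b} \<times> T) g"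
    unfolding g_def by (intro continuous_on_extend_end cont) auto
  moreover have "insert a {a<..<b} = {a..<b}"
    using \<open>a < b\<close> by auto
  ultimately have cont_g: "continuous_on ({a..<b} \<times> T) g" by simp
  have "eventually (\<lambda>x. fst x \<in> {a<..<b} \<and> True) (at_left b \<times>\<^sub>F principal T)"
    using eventually_at_left_real[OF \<open>a < b\<close>] by (rule eventually_prodI) simp
  then have "eventually (\<lambda>x. f x = g x) (at_left b \<times>\<^sub>F principal T)"
    by eventually_elim (auto simp: g_def)
  with lim_b have "(g \<longlongrightarrow> m) (at_left b \<times>\<^sub>F principal T)"
    by (rule Lim_transform_eventually)
  then have "(g \<longlongrightarrow> m) ((at b within {a..<b}) \<times>\<^sub>F principal T)"
    by (rule tendsto_mono[rotated]) (auto intro!: prod_filter_mono at_le)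
  then have "continuous_on (insert b {a..<b} \<times> T) (\<lambda>x. if fst x = b then m else g x)"
    by (intro continuous_on_extend_end cont_g) auto
  moreover have "insert b {a..<b} = {a..b}"
    using \<open>a < b\<close> by auto
  ultimately show ?thesis by (simp only: g_def)
qed

subsection \<open>Lifting families of paths\<close>

definition epe_lift ::
    "(complex \<Rightarrow> complex) \<Rightarrow> 'a::topological_space set \<Rightarrow> (real \<times> 'a \<Rightarrow> complex) \<Rightarrow>
      (real \<times> 'a \<Rightarrow> complex) \<Rightarrow> bool"
  where "epe_lift \<phi> T h H \<longleftrightarrow>
    continuous_on ({0..1} \<times> T) H \<and> H ` ({0<..<1} \<times> T) \<subseteq> ball 0 1 \<and>
    (\<forall>x\<in>{0..1} \<times> T. H x \<in> ext_dom \<phi> \<and> ext_phi \<phi> (H x) = h x)"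

lemma epe_lift_unique:
  assumes cov: "covering_space (ball 0 1) \<phi> \<Omega>" and T: "connected T" "t0 \<in> T" and s0: "s0 \<in> {0..1}"
    and f: "epe_lift \<phi> T h f" and g: "epe_lift \<phi> T h g"
    and base: "f (s0, t0) = g (s0, t0)" "f (s0, t0) \<in> ball 0 1"
    and x: "x \<in> {0..1} \<times> T"
  shows "f x = g x"
proof -
  let ?R = "{0<..<1::real} \<times> T"
  let ?X = "insert (s0, t0) ?R"
  have closure_R: "{0..1::real} \<times> T \<subseteq> closure ?R"
    using closure_subset[of T] by (auto simp: closure_Times)
  have X: "?X \<subseteq> {0..1} \<times> T" using s0 T(2) by auto
  have cont: "continuous_on ({0..1} \<times> T) f" "continuous_on ({0..1} \<times> T) g"
    and in_ball: "f \<in> ?X \<rightarrow> ball 0 1" "g \<in> ?X \<rightarrow> ball 0 1"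
    using f g base unfolding epe_lift_def by auto
  have eq: "\<phi> (f y) = \<phi> (g y)" if "y \<in> ?X" for y
  proof -
    have "f y \<in> ball 0 1" "g y \<in> ball 0 1" using that in_ball by auto
    moreover have "ext_phi \<phi> (f y) = ext_phi \<phi> (g y)"
      using that X f g unfolding epe_lift_def by (metis subsetD)
    ultimately show ?thesis by (simp add: ext_phi_ball)
  qed
  have "f y = g y" if y: "y \<in> ?R" for y
  proof (rule covering_space_lift_unique[OF cov, of f "(s0, t0)" g ?X "\<lambda>x. \<phi> (f x)"])
    show "continuous_on ?X f" "continuous_on ?X g"
      using cont X by (auto intro: continuous_on_subset)
    show "continuous_on ?X (\<lambda>x. \<phi> (f x))"
      using covering_space_imp_continuous[OF cov] \<open>continuous_on ?X f\<close>
      by (rule continuous_on_compose2) (use in_ball in auto)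
    show "(\<lambda>x. \<phi> (f x)) \<in> ?X \<rightarrow> \<Omega>"
      using covering_space_imp_surjective[OF cov] in_ball(1) by blast
    have "connected ?R" using T(1) by (simp add: connected_Times)
    then show "connected ?X"
      by (rule connected_intermediate_closure) (use X closure_R in blast)+
  qed (use in_ball eq y base(1) in auto)
  then show ?thesis
    using continuous_on_eq_on_dense[OF cont _ closure_R _ x] by force
qed

locale epe_family =
  fixes \<Omega> :: "complex set" and \<phi> :: "complex \<Rightarrow> complex" and p q :: complex
    and T :: "'a::real_normed_vector set" and h :: "real \<times> 'a \<Rightarrow> complex"
  assumes bdd: "bounded \<Omega>" and hol: "\<phi> holomorphic_on ball 0 1"
    and cov: "covering_space (ball 0 1) \<phi> \<Omega>" and T: "compact T" "convex T"
    and cont_h: "continuous_on ({0..1} \<times> T) h"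
    and paths: "\<And>t. t \<in> T \<Longrightarrow> path_epe \<Omega> p q (\<lambda>s. h (s, t))"
begin

lemma h_ends:
  assumes "t \<in> T"
  shows "h (0, t) = p" "h (1, t) = q"
  using paths[OF assms] by (simp_all add: path_epe_def)

lemma h_strip: "h \<in> {0<..<1} \<times> T \<rightarrow> \<Omega>"
  using paths by (auto simp: path_epe_def)

lemma strip_lift:
  assumes "s0 \<in> {0..1}" "t0 \<in> T" "zh \<in> ball 0 1" "\<phi> zh = h (s0, t0)"
  obtains K where "continuous_on (insert s0 {0<..<1} \<times> T) K" "K \<in> insert s0 {0<..<1} \<times> T \<rightarrow> ball 0 1"
    "K (s0, t0) = zh" "\<And>x. x \<in> insert s0 {0<..<1} \<times> T \<Longrightarrow> \<phi> (K x) = h x"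
proof -
  let ?X = "insert s0 {0<..<1} \<times> T"
  have "h (s0, t0) \<in> \<Omega>"
    using assms(3,4) covering_space_imp_surjective[OF cov] by (metis imageI)
  \<comment> \<open>If \<open>s0\<close> is an end of the interval, then \<open>h (s0, t)\<close> does not depend on \<open>t\<close>.\<close>
  moreover have "s0 = 0 \<or> s0 = 1 \<or> s0 \<in> {0<..<1}"
    using assms(1) by auto
  ultimately have "h (s0, t) \<in> \<Omega>" if "t \<in> T" for t
    using h_strip h_ends[OF that] h_ends[OF assms(2)] that by (auto simp: Pi_iff)
  then have h_X: "h \<in> ?X \<rightarrow> \<Omega>"
    using h_strip by auto
  have cont_X: "continuous_on ?X h"
    using cont_h by (rule continuous_on_subset) (use assms(1) in auto)
  have "convex (insert s0 {0<..<1})"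
    using assms(1) by (intro is_interval_convex) (auto simp: is_interval_1)
  then have "convex ?X" using T(2) by (rule convex_Times)
  show ?thesis
  proof (rule covering_space_lift_strong[OF cov assms(3) _ _ _ cont_X h_X])
    show "simply_connected ?X" "locally path_connected ?X"
      using \<open>convex ?X\<close> convex_imp_simply_connected convex_imp_locally_path_connected by blast+
  qed (use assms(2,4) that in auto)
qed

lemma strip_lift_converges:
  assumes K: "continuous_on ({0<..<1} \<times> T) K" "K \<in> {0<..<1} \<times> T \<rightarrow> ball 0 1"
      "\<And>x. x \<in> {0<..<1} \<times> T \<Longrightarrow> \<phi> (K x) = h x"
    and A: "path_connected_filter A" "A \<noteq> bot" "eventually (\<lambda>s. s \<in> {0<..<1}) A" and "T \<noteq> {}"
    and lim: "(h \<longlongrightarrow> l) (A \<times>\<^sub>F principal T)"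
  obtains w where "w \<in> ext_dom \<phi>" "ext_phi \<phi> w = l" "(K \<longlongrightarrow> w) (A \<times>\<^sub>F principal T)"
proof -
  let ?F = "A \<times>\<^sub>F principal T"
  have F: "path_connected_filter ?F" "?F \<noteq> bot"
    using A(1,2) \<open>T \<noteq> {}\<close> convex_imp_path_connected[OF T(2)]
    by (simp_all add: prod_filter_eq_bot principal_eq_bot_iff path_connected_filter_prod
        path_connected_filter_principal)
  have "eventually (\<lambda>x. fst x \<in> {0<..<1} \<and> snd x \<in> T) ?F"
    using A(3) by (rule eventually_prodI) (simp add: eventually_principal)
  then have F_strip: "eventually (\<lambda>x. x \<in> {0<..<1} \<times> T) ?F"
    by (simp add: mem_Times_iff)
  then have "eventually (\<lambda>x. h x = \<phi> (K x)) ?F"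
    by eventually_elim (simp add: K(3))
  with lim have "((\<lambda>x. \<phi> (K x)) \<longlongrightarrow> l) ?F"
    by (rule Lim_transform_eventually)
  then show ?thesis
    using lift_converges_in_ext_dom[OF bdd hol cov F F_strip K(1,2)] that by blast
qed

lemma strip_lift_extends:
  assumes K: "continuous_on ({0<..<1} \<times> T) K" "K \<in> {0<..<1} \<times> T \<rightarrow> ball 0 1"
      "\<And>x. x \<in> {0<..<1} \<times> T \<Longrightarrow> \<phi> (K x) = h x" and "T \<noteq> {}"
  obtains H ph qh where "epe_lift \<phi> T h H" "\<And>x. x \<in> {0<..<1} \<times> T \<Longrightarrow> H x = K x"
    "\<And>t. t \<in> T \<Longrightarrow> H (0, t) = ph" "\<And>t. t \<in> T \<Longrightarrow> H (1, t) = qh"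
proof -
  have "(h \<longlongrightarrow> p) (at_right 0 \<times>\<^sub>F principal T)" "(h \<longlongrightarrow> q) (at_left 1 \<times>\<^sub>F principal T)"
    using tendsto_at_within_prod_principal[OF cont_h T(1), of 0 p]
      tendsto_at_within_prod_principal[OF cont_h T(1), of 1 q] h_ends
    by (simp_all add: at_within_Icc_at_right at_within_Icc_at_left)
  then obtain ph qh
    where ph: "ph \<in> ext_dom \<phi>" "ext_phi \<phi> ph = p" "(K \<longlongrightarrow> ph) (at_right 0 \<times>\<^sub>F principal T)"
      and qh: "qh \<in> ext_dom \<phi>" "ext_phi \<phi> qh = q" "(K \<longlongrightarrow> qh) (at_left 1 \<times>\<^sub>F principal T)"
    using strip_lift_converges[OF K path_connected_filter_at_right _ eventually_at_right_real \<open>T \<noteq> {}\<close>]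
      strip_lift_converges[OF K path_connected_filter_at_left _ eventually_at_left_real \<open>T \<noteq> {}\<close>]
    by (metis trivial_limit_at_left_real trivial_limit_at_right_real zero_less_one)
  define H where "H x = (if fst x = 1 then qh else if fst x = 0 then ph else K x)" for x
  have H_eq: "H x = K x" if "x \<in> {0<..<1} \<times> T" for x
    using that by (auto simp: H_def)
  have "continuous_on ({0..1} \<times> T) H"
    unfolding H_def by (rule continuous_on_extend_ends[OF zero_less_one K(1) ph(3) qh(3)])
  moreover have "H ` ({0<..<1} \<times> T) \<subseteq> ball 0 1"
    using H_eq K(2) by auto
  moreover have "H x \<in> ext_dom \<phi> \<and> ext_phi \<phi> (H x) = h x" if x: "x \<in> {0..1} \<times> T" for x
  proof -
    obtain s t where st: "x = (s, t)" "t \<in> T" using x by auto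
    consider "s = 0" | "s = 1" | "x \<in> {0<..<1} \<times> T" using x st by force
    then show ?thesis
    proof cases
      case 3
      then show ?thesis
        using K(2,3) H_eq ext_phi_ball by (metis PiE)
    qed (use ph qh st h_ends in \<open>auto simp: H_def\<close>)
  qed
  ultimately have "epe_lift \<phi> T h H"
    by (simp add: epe_lift_def)
  then show ?thesis
    using that[of H ph qh] H_eq by (simp add: H_def)
qed

lemma epe_lift_exists:
  assumes base: "s0 \<in> {0..1}" "t0 \<in> T" "zh \<in> ball 0 1" "\<phi> zh = h (s0, t0)"
  obtains H ph qh where "epe_lift \<phi> T h H" "H (s0, t0) = zh"
    "\<And>t. t \<in> T \<Longrightarrow> H (0, t) = ph" "\<And>t. t \<in> T \<Longrightarrow> H (1, t) = qh"
proof -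
  let ?R = "{0<..<1::real} \<times> T" and ?X = "insert s0 {0<..<1} \<times> T"
  obtain K where K: "continuous_on ?X K" "K \<in> ?X \<rightarrow> ball 0 1" "K (s0, t0) = zh"
      "\<And>x. x \<in> ?X \<Longrightarrow> \<phi> (K x) = h x"
    using strip_lift[OF base] by blast
  have K_R: "continuous_on ?R K" "K \<in> ?R \<rightarrow> ball 0 1" "\<And>x. x \<in> ?R \<Longrightarrow> \<phi> (K x) = h x"
    using continuous_on_subset[OF K(1), of ?R] K(2,4) by auto
  obtain H ph qh where H: "epe_lift \<phi> T h H" "\<And>x. x \<in> ?R \<Longrightarrow> H x = K x"
    and ends: "\<And>t. t \<in> T \<Longrightarrow> H (0, t) = ph" "\<And>t. t \<in> T \<Longrightarrow> H (1, t) = qh"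
    using strip_lift_extends[OF K_R] base(2) by blast
  have "H (s0, t0) = K (s0, t0)"
  proof (rule continuous_on_eq_on_dense[OF _ K(1), where D = ?R])
    show "continuous_on ?X H"
      using H(1) base(1) by (auto simp: epe_lift_def elim: continuous_on_subset)
    show "?X \<subseteq> closure ?R"
      using base(1) closure_subset[of T] by (auto simp: closure_Times)
  qed (use H(2) base(2) in auto)
  then show ?thesis
    using that[OF H(1) _ ends] K(3) by simp
qed

end

definition epe_path_lift :: "(complex \<Rightarrow> complex) \<Rightarrow> (real \<Rightarrow> complex) \<Rightarrow> (real \<Rightarrow> complex) \<Rightarrow> bool" where
  "epe_path_lift \<phi> \<gamma> \<gamma>h \<longleftrightarrow>
    continuous_on {0..1} \<gamma>h \<and> \<gamma>h ` {0<..<1} \<subseteq> ball 0 1 \<and>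
    (\<forall>s\<in>{0..1}. \<gamma>h s \<in> ext_dom \<phi> \<and> ext_phi \<phi> (\<gamma>h s) = \<gamma> s)"

definition epe_homotopy_lift ::
    "(complex \<Rightarrow> complex) \<Rightarrow> complex \<Rightarrow> complex \<Rightarrow> 'a::topological_space set \<Rightarrow>
      (real \<times> 'a \<Rightarrow> complex) \<Rightarrow> (real \<times> 'a \<Rightarrow> complex) \<Rightarrow> bool"
  where "epe_homotopy_lift \<phi> p q T h H \<longleftrightarrow>
    continuous_on ({0..1} \<times> T) H \<and> H ` ({0..1} \<times> T) \<subseteq> cball 0 1 \<and>
    (\<forall>s\<in>{0<..<1}. \<forall>t\<in>T. H (s, t) \<in> ball 0 1 \<and> \<phi> (H (s, t)) = h (s, t)) \<and>
    (\<exists>ph. H ` ({0} \<times> T) = {ph} \<and> ph \<in> ext_dom \<phi> \<and> ext_phi \<phi> ph = p) \<and>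
    (\<exists>qh. H ` ({1} \<times> T) = {qh} \<and> qh \<in> ext_dom \<phi> \<and> ext_phi \<phi> qh = q)"

lemma epe_lift_singleton_iff_path_lift:
  "epe_lift \<phi> {t} h H \<longleftrightarrow> epe_path_lift \<phi> (\<lambda>s. h (s, t)) (\<lambda>s. H (s, t))"
proof -
  have "continuous_on ({0..1} \<times> {t}) H \<longleftrightarrow> continuous_on {0..1} (\<lambda>s. H (s, t))"
  proof
    assume "continuous_on ({0..1} \<times> {t}) H"
    then show "continuous_on {0..1} (\<lambda>s. H (s, t))"
      by (rule continuous_on_compose2) (auto intro!: continuous_intros)
  next
    assume "continuous_on {0..1} (\<lambda>s. H (s, t))"
    then have "continuous_on ({0..1} \<times> {t}) (\<lambda>x. H (fst x, t))"
      by (rule continuous_on_compose2) (auto intro!: continuous_intros)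
    then show "continuous_on ({0..1} \<times> {t}) H"
      by (rule continuous_on_eq) auto
  qed
  then show ?thesis by (auto simp: epe_lift_def epe_path_lift_def)
qed

lemma epe_homotopy_liftI:
  assumes "T \<noteq> {}" and h: "\<And>t. t \<in> T \<Longrightarrow> path_epe \<Omega> p q (\<lambda>s. h (s, t))"
    and lift: "epe_lift \<phi> T h H"
    and ends: "\<And>t. t \<in> T \<Longrightarrow> H (0, t) = ph" "\<And>t. t \<in> T \<Longrightarrow> H (1, t) = qh"
  shows "epe_homotopy_lift \<phi> p q T h H"
  unfolding epe_homotopy_lift_def
proof (intro conjI ballI exI)
  have H: "H x \<in> ext_dom \<phi>" "ext_phi \<phi> (H x) = h x" if "x \<in> {0..1} \<times> T" for x
    using lift that by (auto simp: epe_lift_def)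
  obtain t0 where "t0 \<in> T" using \<open>T \<noteq> {}\<close> by blast
  show "continuous_on ({0..1} \<times> T) H"
    using lift by (simp add: epe_lift_def)
  show "H ` ({0..1} \<times> T) \<subseteq> cball 0 1"
    using H(1) ext_dom_subset_cball by blast
  show "H ` ({0} \<times> T) = {ph}" "H ` ({1} \<times> T) = {qh}"
    using ends \<open>t0 \<in> T\<close> by (auto simp: image_iff)
  show "ph \<in> ext_dom \<phi>" "ext_phi \<phi> ph = p" "qh \<in> ext_dom \<phi>" "ext_phi \<phi> qh = q"
    using H[of "(0, t0)"] H[of "(1, t0)"] ends[OF \<open>t0 \<in> T\<close>] \<open>t0 \<in> T\<close> h[OF \<open>t0 \<in> T\<close>]
    by (simp_all add: path_epe_def)
  fix s t assume st: "s \<in> {0<..<1::real}" "t \<in> T"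
  then show "H (s, t) \<in> ball 0 1"
    using lift unfolding epe_lift_def by blast
  then show "\<phi> (H (s, t)) = h (s, t)"
    using H(2)[of "(s, t)"] st ext_phi_ball(2)[of "H (s, t)"] by simp
qed

lemma epe_homotopy_lift_imp_epe_lift:
  assumes "epe_homotopy_lift \<phi> p q T h H" and h: "\<And>t. t \<in> T \<Longrightarrow> path_epe \<Omega> p q (\<lambda>s. h (s, t))"
  shows "epe_lift \<phi> T h H"
proof -
  note H = assms(1)[unfolded epe_homotopy_lift_def]
  then obtain ph qh where ends: "H ` ({0} \<times> T) = {ph}" "H ` ({1} \<times> T) = {qh}"
    and ph: "ph \<in> ext_dom \<phi>" "ext_phi \<phi> ph = p" and qh: "qh \<in> ext_dom \<phi>" "ext_phi \<phi> qh = q"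
    by (elim conjE exE)
  have H_ends: "H (0, t) = ph" "H (1, t) = qh" if "t \<in> T" for t
    using ends that by blast+
  have "H (s, t) \<in> ext_dom \<phi> \<and> ext_phi \<phi> (H (s, t)) = h (s, t)" if st: "s \<in> {0..1}" "t \<in> T" for s t
  proof -
    consider "s = 0" | "s = 1" | "s \<in> {0<..<1}" using st(1) by force
    then show ?thesis
    proof cases
      case 3
      then show ?thesis using H st(2) ext_phi_ball by metis
    qed (use H_ends ph qh h[OF st(2)] st(2) in \<open>auto simp: path_epe_def\<close>)
  qed
  moreover have "H ` ({0<..<1} \<times> T) \<subseteq> ball 0 1"
    using H by blast
  ultimately show ?thesis
    using H by (simp add: epe_lift_def)
qed

lemma epe_family_constant:
  fixes T :: "'a::real_normed_vector set"
  assumes "bounded \<Omega>" "\<phi> holomorphic_on ball 0 1" "covering_space (ball 0 1) \<phi> \<Omega>"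
    and "compact T" "convex T" and \<gamma>: "path_epe \<Omega> p q \<gamma>"
  shows "epe_family \<Omega> \<phi> p q T (\<lambda>x. \<gamma> (fst x))"
proof
  have "continuous_on {0..1} \<gamma>"
    using \<gamma> by (simp add: path_epe_def)
  then show "continuous_on ({0..1} \<times> T) (\<lambda>x. \<gamma> (fst x))"
    by (rule continuous_on_compose2) (auto intro!: continuous_intros)
qed (use assms in simp_all)

lemma epe_path_lift_exists_unique:
  assumes "bounded \<Omega>" "\<phi> holomorphic_on ball 0 1" "covering_space (ball 0 1) \<phi> \<Omega>"
    and "path_epe \<Omega> p q \<gamma>" "s0 \<in> {0..1}" "zh \<in> ball 0 1" "\<phi> zh = \<gamma> s0"
  obtains \<gamma>h where "epe_path_lift \<phi> \<gamma> \<gamma>h" "\<gamma>h s0 = zh"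
    "\<And>\<gamma>' s. epe_path_lift \<phi> \<gamma> \<gamma>' \<Longrightarrow> \<gamma>' s0 = zh \<Longrightarrow> s \<in> {0..1} \<Longrightarrow> \<gamma>' s = \<gamma>h s"
proof -
  let ?h = "\<lambda>x. \<gamma> (fst x)" and ?T = "{0::real}"
  interpret epe_family \<Omega> \<phi> p q ?T ?h
    using assms(1-4) by (intro epe_family_constant) auto
  have "\<phi> zh = ?h (s0, 0)" using assms(7) by simp
  then obtain H where H: "epe_lift \<phi> ?T ?h H" "H (s0, 0) = zh"
    using epe_lift_exists[OF assms(5) singletonI assms(6)] by blast
  show ?thesis
  proof (rule that[of "\<lambda>s. H (s, 0)"])
    show "epe_path_lift \<phi> \<gamma> (\<lambda>s. H (s, 0))"
      using H(1) by (simp add: epe_lift_singleton_iff_path_lift)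
    show "\<gamma>' s = H (s, 0)" if "epe_path_lift \<phi> \<gamma> \<gamma>'" "\<gamma>' s0 = zh" "s \<in> {0..1}" for \<gamma>' s
      using epe_lift_unique[OF cov _ _ assms(5) _ H(1), of 0 "\<lambda>x. \<gamma>' (fst x)" "(s, 0)"] that H(2) assms(6)
      by (simp add: epe_lift_singleton_iff_path_lift)
  qed (fact H(2))
qed

lemma epe_homotopy_lift_exists_unique:
  fixes T :: "'a::real_normed_vector set"
  assumes "epe_family \<Omega> \<phi> p q T h"
    and base: "s0 \<in> {0..1}" "t0 \<in> T" "zh \<in> ball 0 1" "\<phi> zh = h (s0, t0)"
  obtains H where "epe_homotopy_lift \<phi> p q T h H" "H (s0, t0) = zh"
    "\<And>H' x. epe_homotopy_lift \<phi> p q T h H' \<Longrightarrow> H' (s0, t0) = zh \<Longrightarrow> x \<in> {0..1} \<times> T \<Longrightarrow> H' x = H x"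
proof -
  interpret epe_family \<Omega> \<phi> p q T h by fact
  obtain H ph qh where H: "epe_lift \<phi> T h H" "H (s0, t0) = zh"
    and ends: "\<And>t. t \<in> T \<Longrightarrow> H (0, t) = ph" "\<And>t. t \<in> T \<Longrightarrow> H (1, t) = qh"
    using epe_lift_exists[OF base] by blast
  show ?thesis
  proof (rule that[of H])
    show "epe_homotopy_lift \<phi> p q T h H"
      using base(2) by (intro epe_homotopy_liftI[OF _ paths H(1) ends]) auto
    show "H' x = H x"
      if "epe_homotopy_lift \<phi> p q T h H'" "H' (s0, t0) = zh" "x \<in> {0..1} \<times> T" for H' x
    proof (rule epe_lift_unique[OF cov convex_connected[OF T(2)] base(2,1) _ H(1) _ _ that(3)])
      show "epe_lift \<phi> T h H'"
        using that(1) paths by (rule epe_homotopy_lift_imp_epe_lift)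
    qed (use that(2) H(2) base(3) in simp_all)
  qed (fact H(2))
qed

theorem theorem2p4:
  fixes \<Omega> :: "complex set" and \<phi> :: "complex \<Rightarrow> complex"
    and p q z zh :: complex
  assumes "bounded \<Omega>" "connected \<Omega>" "open \<Omega>"
    and "\<phi> holomorphic_on ball 0 1"
    and "covering_space (ball 0 1) \<phi> \<Omega>"
    and "p \<in> closure \<Omega>" "q \<in> closure \<Omega>" "z \<in> \<Omega>"
    and "zh \<in> ball 0 1" "\<phi> zh = z"
  shows
   "(\<forall>\<gamma> s0. path_epe \<Omega> p q \<gamma> \<and> s0 \<in> {0..1} \<and> \<gamma> s0 = z \<longrightarrow>
      (\<exists>\<gamma>h. continuous_on {0..1} \<gamma>h \<and> \<gamma>h ` {0<..<1} \<subseteq> ball 0 1 \<and>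
            (\<forall>s\<in>{0..1}. \<gamma>h s \<in> ext_dom \<phi> \<and> ext_phi \<phi> (\<gamma>h s) = \<gamma> s) \<and>
            \<gamma>h s0 = zh \<and>
            (\<forall>\<gamma>'. continuous_on {0..1} \<gamma>' \<and> \<gamma>' ` {0<..<1} \<subseteq> ball 0 1 \<and>
                  (\<forall>s\<in>{0..1}. \<gamma>' s \<in> ext_dom \<phi> \<and> ext_phi \<phi> (\<gamma>' s) = \<gamma> s) \<and>
                  \<gamma>' s0 = zh \<longrightarrow> (\<forall>s\<in>{0..1}. \<gamma>' s = \<gamma>h s))))
    \<and>
    (\<forall>(h :: real \<times> real \<Rightarrow> complex) s0.
       continuous_on ({0..1} \<times> {0..1}) h \<and>
       (\<forall>t\<in>{0..1}. path_epe \<Omega> p q (\<lambda>s. h (s, t))) \<and>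
       s0 \<in> {0..1} \<and> h (s0, 0) = z \<longrightarrow>
      (\<exists>hh. continuous_on ({0..1} \<times> {0..1}) hh \<and>
            hh ` ({0..1} \<times> {0..1}) \<subseteq> cball 0 1 \<and>
            (\<forall>s\<in>{0<..<1}. \<forall>t\<in>{0..1}. hh (s, t) \<in> ball 0 1 \<and> \<phi> (hh (s, t)) = h (s, t)) \<and>
            (\<exists>ph. hh ` ({0} \<times> {0..1}) = {ph} \<and> ph \<in> ext_dom \<phi> \<and> ext_phi \<phi> ph = p) \<and>
            (\<exists>qh. hh ` ({1} \<times> {0..1}) = {qh} \<and> qh \<in> ext_dom \<phi> \<and> ext_phi \<phi> qh = q) \<and>
            hh (s0, 0) = zh \<and>
            (\<forall>hh'. continuous_on ({0..1} \<times> {0..1}) hh' \<and>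
                   hh' ` ({0..1} \<times> {0..1}) \<subseteq> cball 0 1 \<and>
                   (\<forall>s\<in>{0<..<1}. \<forall>t\<in>{0..1}. hh' (s, t) \<in> ball 0 1 \<and> \<phi> (hh' (s, t)) = h (s, t)) \<and>
                   (\<exists>ph. hh' ` ({0} \<times> {0..1}) = {ph} \<and> ph \<in> ext_dom \<phi> \<and> ext_phi \<phi> ph = p) \<and>
                   (\<exists>qh. hh' ` ({1} \<times> {0..1}) = {qh} \<and> qh \<in> ext_dom \<phi> \<and> ext_phi \<phi> qh = q) \<and>
                   hh' (s0, 0) = zh \<longrightarrow>
                   (\<forall>x\<in>{0..1} \<times> {0..1}. hh' x = hh x))))"
proof (intro conjI allI impI, goal_cases)
  case (1 \<gamma> s0)
  then obtain \<gamma>h where "epe_path_lift \<phi> \<gamma> \<gamma>h" "\<gamma>h s0 = zh"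
    "\<And>\<gamma>' s. epe_path_lift \<phi> \<gamma> \<gamma>' \<Longrightarrow> \<gamma>' s0 = zh \<Longrightarrow> s \<in> {0..1} \<Longrightarrow> \<gamma>' s = \<gamma>h s"
    using epe_path_lift_exists_unique[OF assms(1,4,5) _ _ assms(9), of p q \<gamma> s0] assms(10) by blast
  then show ?case
    unfolding epe_path_lift_def by (intro exI[of _ \<gamma>h]) blast
next
  case (2 h s0)
  then have "epe_family \<Omega> \<phi> p q {0..1::real} h"
    using assms(1,4,5) by (intro epe_family.intro) simp_all
  then obtain H where "epe_homotopy_lift \<phi> p q {0..1} h H" "H (s0, 0) = zh"
    "\<And>H' x. epe_homotopy_lift \<phi> p q {0..1} h H' \<Longrightarrow> H' (s0, 0) = zh \<Longrightarrow> x \<in> {0..1} \<times> {0..1} \<Longrightarrow> H' x = H x"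
    using epe_homotopy_lift_exists_unique[of \<Omega> \<phi> p q "{0..1}" h s0 0 zh] 2 assms(9,10) by auto
  then show ?case
    unfolding epe_homotopy_lift_def by (intro exI[of _ H]) blast
qed

end
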